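(* Let $(\mathcal S,\mathcal A,\mu)$ be a $\sigma$-finite measure space, $p(s)\ge0$ with $\int_{\mathcal S}p\,d\mu=1$, and $P(A)=\int_Ap\,d\mu$. Let $(T,\rho)$ be a compact metric space and $f(s,t)$, $s\in\mathcal S$, $t\in T$, a function measurable in $s$ and continuous in $t$ such that $I(t)=\int_{\mathcal S}f(s,t)p(s)\,d\mu(s)$ exists for every $t\in T$. Regard $\xi(t)=f(s,t)$ as a random process on $(\mathcal S,\mathcal A,P)$, so $I(t)=E\xi(t)$. Suppose $\xi(t)$ belongs to the space $\mathbf F_\psi(\Omega)$, for which condition $\mathbf H$ with constant $C_\psi$ is satisfied. Let $Z_n(t)=\frac1n\sum_{i=1}^n\xi_i(t)$ and $\widetilde Z_n(t)=\frac1n\sum_{i=1}^n(\xi_i(t)-I(t))$, where $\xi_i(t)$ are independent copies of the process $\xi(t)$. Let there exist a continuous monotonically increasing function $\sigma(h)$, $\sigma(0)=0$, such that $$\sup_{\rho(t,s)\le h}\|\xi(t)-\xi(s)\|_\psi\le\sigma(h),$$ and suppose that for any $z>0$ $$\int_0^z\varkappa\big(N(\sigma^{(-1)}(u))\big)\,du<\infty,$$ where $\varkappa$ is a majorizing characteristic of $\mathbf F_\psi(\Omega)$ and $N(u)$ is the metric massiveness of $(T,\rho)$. Then for any $0<p<1$ $$\Big\|\sup_{t\in T}|\widetilde Z_n(t)|\Big\|_\psi\le\widehat B(p),\qquad\widehat B(p)=2\sqrt{C_\psi}\inf_{t\in T}\|\xi(t)\|_\psi+\frac1{p(1-p)}\int_0^{\gamma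 p}\varkappa\big(N(\sigma_1^{(-1)}(u))\big)\,du,$$ where $\sigma_1(h)=2\sqrt{C_\psi}\,\sigma(h)$, $\sigma_1^{(-1)}$ is its inverse function, and $\gamma=2\sqrt{C_\psi}\,\sigma\big(\sup_{t,s\in T}\rho(t,s)\big)$. Moreover, $Z_n(t)$ approximates $I(t)$ with reliability $1-\delta$ and accuracy $\varepsilon$ in the space $C(T)$, i.e. $P\{\sup_{t\in T}|Z_n(t)-I(t)|>\varepsilon\}\le\delta$, if $n$ is such that $$\inf_{u\ge1}\frac{\widehat B^u(p)(\psi(u))^u}{(\varepsilon\sqrt n)^u}\le\delta.$$
   Context: $\psi(u)>0$, $u\ge1$, is a monotonically increasing continuous function with $\psi(u)\to\infty$ as $u\to\infty$. $\mathbf F_\psi(\Omega)$ is the Banach space of random variables with norm $\|\xi\|_\psi=\sup_{u\ge1}\frac{(E|\xi|^u)^{1/u}}{\psi(u)}<\infty$; a process belongs to it if each of its values does. Condition $\mathbf H$ with constant $C_\psi$: for any centered independent $\xi_1,\dots,\xi_n$ from the space, $\|\sum_{i=1}^n\xi_i\|_\psi^2\le C_\psi\sum_{i=1}^n\|\xi_i\|_\psi^2$. A majorizing characteristic is a non-decreasing sequence $\varkappa(n)$ with $\|\max_{1\le i\le n}|\xi_i|\|_\psi\le\varkappa(n)\max_{1\le i\le n}\|\xi_i\|_\psi$ for all $\xi_1,\dots,\xi_n\in\mathbf F_\psi(\Omega)$. The metric massiveness $N(u)$ of $(T,\rho)$ is the smallest number of closed balls of radius at most $u$ covering $T$. The number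 $p\in(0,1)$ in $\widehat B(p)$ is unrelated to the density $p(s)$. Independent copies are of the form $\xi_i(t)=f(s_i,t)$ with $s_i$ independent with law $P$. *)

theory Defs
  imports "HOL-Probability.Probability"
begin

text \<open>
  The integral of a non-integrable function is 0 and the supremum of an unbounded set of
  reals is an unspecified real, so \<open>psi_norm\<close> is the norm of the Banach space only on \<open>psi_space\<close>,
  where both are excluded.
\<close>

definition psi_space :: "'w measure \<Rightarrow> (real \<Rightarrow> real) \<Rightarrow> ('w \<Rightarrow> real) set" where
  "psi_space M \<psi> = {X \<in> borel_measurable M.
     (\<forall>u\<ge>1. integrable M (\<lambda>\<omega>. \<bar>X \<omega>\<bar> powr u)) \<and>
     bdd_above ((\<lambda>u. (\<integral>\<omega>. \<bar>X \<omega>\<bar> powr u \<partial>M) powr (1 / u) / \<psi> u) ` {1..})}"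

definition psi_norm :: "'w measure \<Rightarrow> (real \<Rightarrow> real) \<Rightarrow> ('w \<Rightarrow> real) \<Rightarrow> real" where
  "psi_norm M \<psi> X = (SUP u\<in>{1..}. (\<integral>\<omega>. \<bar>X \<omega>\<bar> powr u \<partial>M) powr (1 / u) / \<psi> u)"

definition psi_function :: "(real \<Rightarrow> real) \<Rightarrow> bool" where
  "psi_function \<psi> \<longleftrightarrow> (\<forall>u\<ge>1. \<psi> u > 0) \<and> mono_on {1..} \<psi> \<and> continuous_on {1..} \<psi> \<and>
     filterlim \<psi> at_top at_top"

definition condition_H :: "'w measure \<Rightarrow> (real \<Rightarrow> real) \<Rightarrow> real \<Rightarrow> bool" where
  "condition_H M \<psi> C \<longleftrightarrow>
     (\<forall>n (\<xi> :: nat \<Rightarrow> 'w \<Rightarrow> real).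
        (\<forall>i\<in>{1..n}. \<xi> i \<in> psi_space M \<psi> \<and> (\<integral>\<omega>. \<xi> i \<omega> \<partial>M) = 0) \<and>
        prob_space.indep_vars M (\<lambda>_. borel) \<xi> {1..n} \<longrightarrow>
        (psi_norm M \<psi> (\<lambda>\<omega>. \<Sum>i=1..n. \<xi> i \<omega>))\<^sup>2 \<le> C * (\<Sum>i=1..n. (psi_norm M \<psi> (\<xi> i))\<^sup>2))"

definition majorizing_characteristic ::
    "'w measure \<Rightarrow> (real \<Rightarrow> real) \<Rightarrow> (nat \<Rightarrow> real) \<Rightarrow> bool" where
  "majorizing_characteristic M \<psi> \<kappa> \<longleftrightarrow>
     mono_on {1..} \<kappa> \<and>
     (\<forall>n\<ge>1. \<forall>\<xi> :: nat \<Rightarrow> 'w \<Rightarrow> real. (\<forall>i\<in>{1..n}. \<xi> i \<in> psi_space M \<psi>) \<longrightarrow>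
        psi_norm M \<psi> (\<lambda>\<omega>. MAX i\<in>{1..n}. \<bar>\<xi> i \<omega>\<bar>) \<le> \<kappa> n * (MAX i\<in>{1..n}. psi_norm M \<psi> (\<xi> i)))"

text \<open>
  The balls have their centres in \<open>T\<close>. For compact \<open>T\<close> and \<open>u > 0\<close> a finite cover exists; for
  \<open>u \<le> 0\<close> the value carries no meaning, and the integrals below do not see it.
\<close>

definition massiveness :: "'t::metric_space set \<Rightarrow> real \<Rightarrow> nat" where
  "massiveness T u = (LEAST n. \<exists>(c :: nat \<Rightarrow> 't) (r :: nat \<Rightarrow> real).
     (\<forall>i<n. c i \<in> T \<and> 0 \<le> r i \<and> r i \<le> u) \<and> T \<subseteq> (\<Union>i<n. cball (c i) (r i)))"

text \<open>The inverse of a strictly increasing function on \<open>[0,\<infinity>)\<close>; meaningful only on the range.\<close>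

abbreviation inverse_fun :: "(real \<Rightarrow> real) \<Rightarrow> real \<Rightarrow> real" where
  "inverse_fun \<sigma> \<equiv> the_inv_into {0..} \<sigma>"

definition Z_mean :: "('s \<Rightarrow> 't \<Rightarrow> real) \<Rightarrow> (nat \<Rightarrow> 'w \<Rightarrow> 's) \<Rightarrow> nat \<Rightarrow> 'w \<Rightarrow> 't \<Rightarrow> real" where
  "Z_mean f s n \<omega> t = 1 / real n * (\<Sum>i=1..n. f (s i \<omega>) t)"

definition Z_centered ::
    "('s \<Rightarrow> 't \<Rightarrow> real) \<Rightarrow> ('t \<Rightarrow> real) \<Rightarrow> (nat \<Rightarrow> 'w \<Rightarrow> 's) \<Rightarrow> nat \<Rightarrow> 'w \<Rightarrow> 't \<Rightarrow> real" where
  "Z_centered f I s n \<omega> t = 1 / real n * (\<Sum>i=1..n. f (s i \<omega>) t - I t)"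

text \<open>
  For \<open>0 < p < 1\<close> the interval of integration lies in the range of \<open>\<sigma>\<^sub>1\<close>, since \<open>\<gamma>\<close> is the value
  of \<open>\<sigma>\<^sub>1\<close> at the diameter of \<open>T\<close>.
\<close>

definition B_hat :: "'s measure \<Rightarrow> (real \<Rightarrow> real) \<Rightarrow> real \<Rightarrow> (nat \<Rightarrow> real) \<Rightarrow> (real \<Rightarrow> real) \<Rightarrow>
    't::metric_space set \<Rightarrow> ('s \<Rightarrow> 't \<Rightarrow> real) \<Rightarrow> real \<Rightarrow> real" where
  "B_hat P \<psi> C \<kappa> \<sigma> T f p =
     (let \<sigma>\<^sub>1 = (\<lambda>h. 2 * sqrt C * \<sigma> h);
          \<gamma> = 2 * sqrt C * \<sigma> (diameter T)
      in 2 * sqrt C * (INF t\<in>T. psi_norm P \<psi> (\<lambda>x. f x t)) +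
         1 / (p * (1 - p)) *
           (LBINT u:{0<..<\<gamma> * p}. \<kappa> (massiveness T (inverse_fun \<sigma>\<^sub>1 u))))"

end

theory Submission
  imports Defs
begin

text \<open>
  The proof is a chaining argument for the rescaled process \<open>X t = sqrt n * Z_centered\<close>. Its point is
  that all bounds for \<open>X\<close> are uniform in \<open>n\<close>. Centring a variable at most doubles its norm
  (\<open>moment_bound_center\<close>). By condition \<open>H\<close> a sum of \<open>n\<close> independent centred copies has norm at most
  \<open>sqrt (C n)\<close> times that of one of them, so \<open>X t\<close> and its increments have norms at most \<open>2 sqrt C\<close> times those
  of \<open>f\<close> (\<open>moment_bound_normalized_sum\<close>). In particular \<open>\<sigma>\<^sub>1 = 2 sqrt C \<sigma>\<close> is a modulus of continuity of
  \<open>X\<close> in the norm.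

  For a process with such a modulus, choose radii \<open>h k\<close> with \<open>\<sigma>\<^sub>1 (h k) = \<gamma> p ^ k\<close> and nets of
  minimal size for them, the net at level \<open>0\<close> being an arbitrary point \<open>t0\<close>. Moving from one net to the
  next changes the maximum of \<open>\<bar>X\<bar>\<close> by at most the maximum of \<open>massiveness T (h (Suc k))\<close> increments of norm at
  most \<open>\<gamma> p ^ k\<close>, whose norm the majorizing characteristic controls (\<open>moment_bound_Sup_chaining\<close>).
  The sum of these contributions is a lower Riemann sum, up to the factor
  \<open>1 / (p (1 - p))\<close>, of the entropy integral over \<open>(0, \<gamma> p)\<close> (\<open>geometric_sum_le_integral\<close>). As the paths are
  continuous, the maxima over the nets converge to the supremum over \<open>T\<close>, and Fatou's lemma
  carries the bound over. The result is \<open>psi_norm_Sup_le_entropy_integral\<close>; taking the best \<open>t0\<close>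
  gives \<open>B_hat\<close> as a bound for the norm of \<open>sup \<bar>X\<bar>\<close>, so the supremum of \<open>\<bar>Z_centered\<bar>\<close> has norm
  at most \<open>B_hat / sqrt n\<close>. The tail bound is Markov's inequality for its moments (\<open>moment_bound_tail\<close>).

  Norm estimates are handled through the predicate \<open>moment_bound M \<psi> B X\<close>, which for \<open>B \<ge> 0\<close> expresses that \<open>X\<close>
  lies in the space and has norm at most \<open>B\<close>.
\<close>

section \<open>Minkowski's inequality for moments\<close>

text \<open>
  \<open>powr_convex\<close> lives on the open half-line. The moments below need the point \<open>0\<close> as well, where the
  inequality reduces to \<open>c powr u \<le> c\<close> for \<open>0 \<le> c \<le> 1\<close>.
\<close>

lemma powr_convex_combination:
  fixes x y l m u :: real
  assumes "0 \<le> x" "0 \<le> y" "0 \<le> l" "0 \<le> m" "l + m = 1" "1 \<le> u"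
  shows "(l * x + m * y) powr u \<le> l * x powr u + m * y powr u"
proof -
  have shrink: "(c * z) powr u \<le> c * z powr u" if "0 \<le> c" "c \<le> 1" "0 \<le> z" for c z :: real
  proof -
    have "c powr u \<le> c"
    proof (cases "c = 0")
      case False
      then show ?thesis
        using powr_mono'[of 1 u c] that assms(6) by simp
    qed simp
    then show ?thesis
      using that by (simp add: powr_mult mult_right_mono)
  qed
  consider "x = 0" | "y = 0" | "x > 0" "y > 0"
    using assms by fastforce
  then show ?thesis
  proof cases
    case 1
    then show ?thesis using shrink[of m y] assms by auto
  next
    case 2
    then show ?thesis using shrink[of l x] assms by auto
  next
    case 3
    have "l = 1 - m" "m \<le> 1" using assms by auto
    then show ?thesis
      using convex_onD[OF powr_convex[OF assms(6)], of m x y] 3 assms(4) by simp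
  qed
qed

text \<open>
  The pointwise form of Minkowski's inequality: if \<open>a\<close> and \<open>b\<close> bound the \<open>L\<^sup>u\<close> norms of \<open>x\<close> and \<open>y\<close>, the
  right-hand side integrates to at most \<open>(a + b) powr u\<close>. It is convexity applied to
  \<open>x + y = (a + b) (a/(a+b) (x/a) + b/(a+b) (y/b))\<close>.
\<close>

lemma powr_sum_le:
  fixes x y a b u :: real
  assumes "0 < a" "0 < b" "1 \<le> u"
  shows "\<bar>x + y\<bar> powr u
    \<le> (a + b) powr u * (a / (a + b) * (\<bar>x\<bar> powr u / a powr u) + b / (a + b) * (\<bar>y\<bar> powr u / b powr u))"
proof -
  have "\<bar>x + y\<bar> powr u \<le> (\<bar>x\<bar> + \<bar>y\<bar>) powr u"
    using assms by (intro powr_mono2) auto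
  also have "\<bar>x\<bar> + \<bar>y\<bar> = (a + b) * (a / (a + b) * (\<bar>x\<bar> / a) + b / (a + b) * (\<bar>y\<bar> / b))"
  proof -
    have "(a + b) * (a / (a + b) * (\<bar>x\<bar> / a)) = \<bar>x\<bar>" "(a + b) * (b / (a + b) * (\<bar>y\<bar> / b)) = \<bar>y\<bar>"
      using assms by simp_all
    then show ?thesis by (simp only: distrib_left)
  qed
  also have "\<dots> powr u
      = (a + b) powr u * (a / (a + b) * (\<bar>x\<bar> / a) + b / (a + b) * (\<bar>y\<bar> / b)) powr u"
    by (simp only: powr_mult)
  also have "\<dots> \<le> (a + b) powr u
      * (a / (a + b) * (\<bar>x\<bar> / a) powr u + b / (a + b) * (\<bar>y\<bar> / b) powr u)"
  proof (intro mult_left_mono powr_convex_combination)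
    show "a / (a + b) + b / (a + b) = 1"
      using assms by (simp flip: add_divide_distrib)
  qed (use assms in auto)
  finally show ?thesis
    by (simp only: powr_divide)
qed

lemma nn_integral_powr_add_le:
  fixes X Y :: "'w \<Rightarrow> real"
  assumes [measurable]: "X \<in> borel_measurable M" "Y \<in> borel_measurable M"
    and "1 \<le> u" "0 < a" "0 < b"
    and X: "(\<integral>\<^sup>+\<omega>. ennreal (\<bar>X \<omega>\<bar> powr u) \<partial>M) \<le> ennreal (a powr u)"
    and Y: "(\<integral>\<^sup>+\<omega>. ennreal (\<bar>Y \<omega>\<bar> powr u) \<partial>M) \<le> ennreal (b powr u)"
  shows "(\<integral>\<^sup>+\<omega>. ennreal (\<bar>X \<omega> + Y \<omega>\<bar> powr u) \<partial>M) \<le> ennreal ((a + b) powr u)"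
proof -
  define A where "A = (a + b) powr u * (a / (a + b)) / a powr u"
  define B where "B = (a + b) powr u * (b / (a + b)) / b powr u"
  have nonneg: "0 \<le> A" "0 \<le> B"
    using assms by (auto simp: A_def B_def)
  have "(\<integral>\<^sup>+\<omega>. ennreal (\<bar>X \<omega> + Y \<omega>\<bar> powr u) \<partial>M)
      \<le> (\<integral>\<^sup>+\<omega>. ennreal A * ennreal (\<bar>X \<omega>\<bar> powr u) + ennreal B * ennreal (\<bar>Y \<omega>\<bar> powr u) \<partial>M)"
  proof (intro nn_integral_mono)
    fix \<omega>
    have "\<bar>X \<omega> + Y \<omega>\<bar> powr u \<le> A * \<bar>X \<omega>\<bar> powr u + B * \<bar>Y \<omega>\<bar> powr u"
      using powr_sum_le[OF assms(4,5,3), of "X \<omega>" "Y \<omega>"]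
      by (simp add: A_def B_def algebra_simps)
    then show "ennreal (\<bar>X \<omega> + Y \<omega>\<bar> powr u)
        \<le> ennreal A * ennreal (\<bar>X \<omega>\<bar> powr u) + ennreal B * ennreal (\<bar>Y \<omega>\<bar> powr u)"
      using nonneg by (simp flip: ennreal_mult ennreal_plus)
  qed
  also have "\<dots> = ennreal A * (\<integral>\<^sup>+\<omega>. ennreal (\<bar>X \<omega>\<bar> powr u) \<partial>M)
      + ennreal B * (\<integral>\<^sup>+\<omega>. ennreal (\<bar>Y \<omega>\<bar> powr u) \<partial>M)"
    by (simp add: nn_integral_add nn_integral_cmult)
  also have "\<dots> \<le> ennreal A * ennreal (a powr u) + ennreal B * ennreal (b powr u)"
    by (intro add_mono mult_left_mono X Y) auto
  also have "\<dots> = ennreal (A * a powr u + B * b powr u)"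
    using nonneg by (simp flip: ennreal_mult ennreal_plus)
  also have "A * a powr u + B * b powr u = (a + b) powr u"
  proof -
    have "A * a powr u = (a + b) powr u * (a / (a + b))"
      and "B * b powr u = (a + b) powr u * (b / (a + b))"
      using assms(4,5) by (simp_all add: A_def B_def)
    moreover have "a / (a + b) + b / (a + b) = 1"
      using assms(4,5) by (simp flip: add_divide_distrib)
    ultimately show ?thesis
      by (metis distrib_left mult.right_neutral)
  qed
  finally show ?thesis .
qed

section \<open>Bounds for all moments and the psi-norm\<close>

text \<open>
  The inequality \<open>psi_norm M \<psi> X \<le> B\<close> says something about \<open>X\<close> only once \<open>X\<close> is known to lie in
  \<open>psi_space M \<psi>\<close>. For \<open>B \<ge> 0\<close> the predicate below combines both facts
  (see \<open>moment_bound_iff\<close>). It is phrased with the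
  nonnegative integral, so that domination, Fatou's lemma and Markov's inequality apply to it directly.
\<close>

definition moment_bound :: "'w measure \<Rightarrow> (real \<Rightarrow> real) \<Rightarrow> real \<Rightarrow> ('w \<Rightarrow> real) \<Rightarrow> bool" where
  "moment_bound M \<psi> B X \<longleftrightarrow> X \<in> borel_measurable M \<and>
     (\<forall>u\<ge>1. (\<integral>\<^sup>+\<omega>. ennreal (\<bar>X \<omega>\<bar> powr u) \<partial>M) \<le> ennreal ((B * \<psi> u) powr u))"

lemma psi_function_pos: "psi_function \<psi> \<Longrightarrow> 1 \<le> u \<Longrightarrow> 0 < \<psi> u"
  by (auto simp: psi_function_def)

lemma psi_norm_nonneg:
  assumes "psi_function \<psi>" "X \<in> psi_space M \<psi>"
  shows "0 \<le> psi_norm M \<psi> X"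
  unfolding psi_norm_def
proof (rule cSUP_upper2[where x = 1])
  show "bdd_above ((\<lambda>u. (\<integral>\<omega>. \<bar>X \<omega>\<bar> powr u \<partial>M) powr (1 / u) / \<psi> u) ` {1..})"
    using assms(2) by (simp add: psi_space_def)
qed (use psi_function_pos[OF assms(1), of 1] in auto)

lemma powr_root_le_iff:
  fixes m b u :: real
  assumes "0 \<le> m" "0 \<le> b" "1 \<le> u"
  shows "m powr (1 / u) \<le> b \<longleftrightarrow> m \<le> b powr u"
proof
  assume "m powr (1 / u) \<le> b"
  then have "(m powr (1 / u)) powr u \<le> b powr u"
    using assms by (intro powr_mono2) auto
  then show "m \<le> b powr u" using assms by (simp add: powr_powr)
next
  assume "m \<le> b powr u"
  then have "m powr (1 / u) \<le> (b powr u) powr (1 / u)"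
    using assms by (intro powr_mono2) auto
  then show "m powr (1 / u) \<le> b" using assms by (simp add: powr_powr)
qed

lemma moment_bound_iff:
  assumes \<psi>: "psi_function \<psi>" and B: "0 \<le> B"
  shows "moment_bound M \<psi> B X \<longleftrightarrow> X \<in> psi_space M \<psi> \<and> psi_norm M \<psi> X \<le> B"
proof -
  have pos: "0 < \<psi> u" if "1 \<le> u" for u using psi_function_pos[OF \<psi> that] .
  have eq: "(\<integral>\<omega>. \<bar>X \<omega>\<bar> powr u \<partial>M) powr (1 / u) / \<psi> u \<le> B
      \<longleftrightarrow> (\<integral>\<^sup>+\<omega>. ennreal (\<bar>X \<omega>\<bar> powr u) \<partial>M) \<le> ennreal ((B * \<psi> u) powr u)"
    if "integrable M (\<lambda>\<omega>. \<bar>X \<omega>\<bar> powr u)" "1 \<le> u" for u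
  proof -
    have "(\<integral>\<omega>. \<bar>X \<omega>\<bar> powr u \<partial>M) powr (1 / u) / \<psi> u \<le> B
        \<longleftrightarrow> (\<integral>\<omega>. \<bar>X \<omega>\<bar> powr u \<partial>M) powr (1 / u) \<le> B * \<psi> u"
      using pos[OF that(2)] by (simp add: pos_divide_le_eq)
    also have "\<dots> \<longleftrightarrow> (\<integral>\<omega>. \<bar>X \<omega>\<bar> powr u \<partial>M) \<le> (B * \<psi> u) powr u"
      using pos[OF that(2)] that B by (intro powr_root_le_iff) auto
    finally show ?thesis
      using that by (simp add: nn_integral_eq_integral)
  qed
  show ?thesis
  proof
    assume mb: "moment_bound M \<psi> B X"
    then have meas [measurable]: "X \<in> borel_measurable M" by (simp add: moment_bound_def)
    have int: "integrable M (\<lambda>\<omega>. \<bar>X \<omega>\<bar> powr u)" if "1 \<le> u" for u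
    proof (rule integrableI_nonneg)
      show "(\<integral>\<^sup>+\<omega>. ennreal (\<bar>X \<omega>\<bar> powr u) \<partial>M) < \<infinity>"
        using mb that le_less_trans[OF _ ennreal_less_top] by (auto simp: moment_bound_def)
    qed auto
    have le: "(\<integral>\<omega>. \<bar>X \<omega>\<bar> powr u \<partial>M) powr (1 / u) / \<psi> u \<le> B" if "1 \<le> u" for u
      using mb that eq[OF int[OF that] that] by (simp add: moment_bound_def)
    show "X \<in> psi_space M \<psi> \<and> psi_norm M \<psi> X \<le> B"
      using int le unfolding psi_space_def psi_norm_def
      by (auto intro!: bdd_aboveI[of _ B] cSUP_least)
  next
    assume X: "X \<in> psi_space M \<psi> \<and> psi_norm M \<psi> X \<le> B"
    have "(\<integral>\<^sup>+\<omega>. ennreal (\<bar>X \<omega>\<bar> powr u) \<partial>M) \<le> ennreal ((B * \<psi> u) powr u)" if "1 \<le> u" for u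
    proof -
      have "(\<integral>\<omega>. \<bar>X \<omega>\<bar> powr u \<partial>M) powr (1 / u) / \<psi> u \<le> psi_norm M \<psi> X"
        using X that unfolding psi_norm_def psi_space_def by (intro cSUP_upper) auto
      then show ?thesis
        using eq[of u] X that by (auto simp: psi_space_def)
    qed
    then show "moment_bound M \<psi> B X"
      using X by (auto simp: moment_bound_def psi_space_def)
  qed
qed

lemma psi_norm_le:
  assumes "psi_function \<psi>" "0 \<le> B" "moment_bound M \<psi> B X"
  shows "X \<in> psi_space M \<psi>" "psi_norm M \<psi> X \<le> B"
  using moment_bound_iff[OF assms(1,2)] assms(3) by blast+

lemma moment_bound_psi_norm:
  assumes "psi_function \<psi>" "X \<in> psi_space M \<psi>"
  shows "moment_bound M \<psi> (psi_norm M \<psi> X) X"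
  using moment_bound_iff[OF assms(1) psi_norm_nonneg[OF assms]] assms(2) by blast

lemma moment_bound_dominated:
  assumes "moment_bound M \<psi> B Y" "X \<in> borel_measurable M"
    and "\<And>\<omega>. \<omega> \<in> space M \<Longrightarrow> \<bar>X \<omega>\<bar> \<le> \<bar>Y \<omega>\<bar>"
  shows "moment_bound M \<psi> B X"
  unfolding moment_bound_def
proof (intro conjI allI impI)
  fix u :: real assume "1 \<le> u"
  have "(\<integral>\<^sup>+\<omega>. ennreal (\<bar>X \<omega>\<bar> powr u) \<partial>M) \<le> (\<integral>\<^sup>+\<omega>. ennreal (\<bar>Y \<omega>\<bar> powr u) \<partial>M)"
    using assms(3) \<open>1 \<le> u\<close> by (intro nn_integral_mono ennreal_leI powr_mono2) auto
  also have "\<dots> \<le> ennreal ((B * \<psi> u) powr u)"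
    using assms(1) \<open>1 \<le> u\<close> by (simp add: moment_bound_def)
  finally show "(\<integral>\<^sup>+\<omega>. ennreal (\<bar>X \<omega>\<bar> powr u) \<partial>M) \<le> ennreal ((B * \<psi> u) powr u)" .
qed fact

lemma moment_bound_cong:
  assumes "moment_bound M \<psi> B X" "\<And>\<omega>. \<omega> \<in> space M \<Longrightarrow> X \<omega> = Y \<omega>"
  shows "moment_bound M \<psi> B Y"
proof (rule moment_bound_dominated[OF assms(1)])
  show "Y \<in> borel_measurable M"
    using assms measurable_cong[of M X Y borel] by (simp add: moment_bound_def)
qed (simp add: assms(2))

lemma moment_bound_mono:
  assumes "psi_function \<psi>" "moment_bound M \<psi> B X" "0 \<le> B" "B \<le> B'"
  shows "moment_bound M \<psi> B' X"
proof -
  have "X \<in> psi_space M \<psi> \<and> psi_norm M \<psi> X \<le> B"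
    using assms(2) moment_bound_iff[OF assms(1,3)] by blast
  moreover have "0 \<le> B'" using assms(3,4) by simp
  ultimately show ?thesis
    using assms(4) moment_bound_iff[OF assms(1)] by (meson order_trans)
qed

lemma moment_bound_cmult:
  assumes \<psi>: "psi_function \<psi>" and X: "moment_bound M \<psi> B X" and B: "0 \<le> B"
  shows "moment_bound M \<psi> (\<bar>c\<bar> * B) (\<lambda>\<omega>. c * X \<omega>)"
  unfolding moment_bound_def
proof (intro conjI allI impI)
  have [measurable]: "X \<in> borel_measurable M" using X by (simp add: moment_bound_def)
  show "(\<lambda>\<omega>. c * X \<omega>) \<in> borel_measurable M" by measurable
  fix u :: real assume u: "1 \<le> u"
  have "(\<integral>\<^sup>+\<omega>. ennreal (\<bar>c * X \<omega>\<bar> powr u) \<partial>M)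
      = (\<integral>\<^sup>+\<omega>. ennreal (\<bar>c\<bar> powr u) * ennreal (\<bar>X \<omega>\<bar> powr u) \<partial>M)"
    by (simp add: abs_mult powr_mult ennreal_mult)
  also have "\<dots> = ennreal (\<bar>c\<bar> powr u) * (\<integral>\<^sup>+\<omega>. ennreal (\<bar>X \<omega>\<bar> powr u) \<partial>M)"
    by (simp add: nn_integral_cmult)
  also have "\<dots> \<le> ennreal (\<bar>c\<bar> powr u) * ennreal ((B * \<psi> u) powr u)"
    using X u by (intro mult_left_mono) (auto simp: moment_bound_def)
  also have "\<dots> = ennreal ((\<bar>c\<bar> * B * \<psi> u) powr u)"
    using B psi_function_pos[OF \<psi> u] by (simp add: powr_mult ennreal_mult mult.assoc)
  finally show "(\<integral>\<^sup>+\<omega>. ennreal (\<bar>c * X \<omega>\<bar> powr u) \<partial>M) \<le> ennreal ((\<bar>c\<bar> * B * \<psi> u) powr u)" .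
qed

text \<open>
  The triangle inequality. The pointwise inequality above divides by the two bounds, so each of
  them is first enlarged by \<open>e / 2 > 0\<close> and \<open>e\<close> then tends to \<open>0\<close>.
\<close>

lemma moment_bound_add:
  assumes \<psi>: "psi_function \<psi>" and X: "moment_bound M \<psi> A X" and Y: "moment_bound M \<psi> B Y"
    and nonneg: "0 \<le> A" "0 \<le> B"
  shows "moment_bound M \<psi> (A + B) (\<lambda>\<omega>. X \<omega> + Y \<omega>)"
proof -
  have [measurable]: "X \<in> borel_measurable M" "Y \<in> borel_measurable M"
    using X Y by (auto simp: moment_bound_def)
  have strict: "moment_bound M \<psi> (A + B + e) (\<lambda>\<omega>. X \<omega> + Y \<omega>)" if "e > 0" for e
    unfolding moment_bound_def
  proof (intro conjI allI impI)
    fix u :: real assume u: "1 \<le> u"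
    have "moment_bound M \<psi> (A + e / 2) X" "moment_bound M \<psi> (B + e / 2) Y"
      using that nonneg by (auto intro: moment_bound_mono[OF \<psi> X] moment_bound_mono[OF \<psi> Y])
    then have "(\<integral>\<^sup>+\<omega>. ennreal (\<bar>X \<omega> + Y \<omega>\<bar> powr u) \<partial>M)
        \<le> ennreal (((A + e / 2) * \<psi> u + (B + e / 2) * \<psi> u) powr u)"
      using u that nonneg psi_function_pos[OF \<psi> u]
      by (intro nn_integral_powr_add_le) (auto simp: moment_bound_def)
    then show "(\<integral>\<^sup>+\<omega>. ennreal (\<bar>X \<omega> + Y \<omega>\<bar> powr u) \<partial>M) \<le> ennreal (((A + B + e) * \<psi> u) powr u)"
      by (simp add: algebra_simps)
  qed simp
  have "psi_norm M \<psi> (\<lambda>\<omega>. X \<omega> + Y \<omega>) \<le> A + B"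
  proof (rule field_le_epsilon)
    fix e :: real assume "e > 0"
    then show "psi_norm M \<psi> (\<lambda>\<omega>. X \<omega> + Y \<omega>) \<le> A + B + e"
      using strict[of e] nonneg
        moment_bound_iff[OF \<psi>, of "A + B + e" M "\<lambda>\<omega>. X \<omega> + Y \<omega>"] by simp
  qed
  then show ?thesis
    using strict[of 1] nonneg
      moment_bound_iff[OF \<psi>, of "A + B + 1" M "\<lambda>\<omega>. X \<omega> + Y \<omega>"]
      moment_bound_iff[OF \<psi>, of "A + B" M "\<lambda>\<omega>. X \<omega> + Y \<omega>"] by simp
qed

text \<open>
  Since \<open>\<psi>\<close> is increasing, the supremum that defines the norm of a constant is attained at \<open>u = 1\<close>.
\<close>

lemma moment_bound_const:
  assumes "prob_space M" "psi_function \<psi>"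
  shows "moment_bound M \<psi> (\<bar>c\<bar> / \<psi> 1) (\<lambda>_. c)"
  unfolding moment_bound_def
proof (intro conjI allI impI)
  fix u :: real assume u: "1 \<le> u"
  have "0 < \<psi> 1" "\<psi> 1 \<le> \<psi> u"
    using assms(2) u by (auto simp: psi_function_def mono_on_def)
  then have "\<bar>c\<bar> \<le> \<bar>c\<bar> / \<psi> 1 * \<psi> u"
    by (simp add: pos_le_divide_eq mult_left_mono)
  then have "\<bar>c\<bar> powr u \<le> (\<bar>c\<bar> / \<psi> 1 * \<psi> u) powr u"
    using u by (intro powr_mono2) auto
  then show "(\<integral>\<^sup>+\<omega>. ennreal (\<bar>c\<bar> powr u) \<partial>M) \<le> ennreal ((\<bar>c\<bar> / \<psi> 1 * \<psi> u) powr u)"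
    using prob_space.emeasure_space_1[OF assms(1)] by (simp add: ennreal_leI)
qed simp

lemma moment_bound_sum:
  assumes \<psi>: "psi_function \<psi>" and "finite S"
    and "\<And>i. i \<in> S \<Longrightarrow> moment_bound M \<psi> (B i) (X i)" "\<And>i. i \<in> S \<Longrightarrow> 0 \<le> B i"
  shows "moment_bound M \<psi> (\<Sum>i\<in>S. B i) (\<lambda>\<omega>. \<Sum>i\<in>S. X i \<omega>)"
  using assms(2-)
proof (induction S rule: finite_induct)
  case empty
  then show ?case by (simp add: moment_bound_def)
next
  case (insert i S)
  then show ?case
    using moment_bound_add[OF \<psi>, of M "B i" "X i" "sum B S" "\<lambda>\<omega>. \<Sum>i\<in>S. X i \<omega>"]
    by (simp add: sum_nonneg)
qed

text \<open>
  Fatou's lemma: balls of the space are closed under pointwise limits. This carries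
  bounds for finite maxima over to the supremum of a process with continuous paths.
\<close>

lemma moment_bound_LIMSEQ:
  assumes W: "\<And>k. moment_bound M \<psi> B (W k)"
    and lim: "\<And>\<omega>. \<omega> \<in> space M \<Longrightarrow> (\<lambda>k. W k \<omega>) \<longlonglongrightarrow> Z \<omega>"
  shows "moment_bound M \<psi> B Z"
  unfolding moment_bound_def
proof (intro conjI allI impI)
  have [measurable]: "W k \<in> borel_measurable M" for k
    using W by (simp add: moment_bound_def)
  show "Z \<in> borel_measurable M"
    by (rule borel_measurable_LIMSEQ_real[OF lim]) auto
  fix u :: real assume u: "1 \<le> u"
  have "(\<integral>\<^sup>+\<omega>. ennreal (\<bar>Z \<omega>\<bar> powr u) \<partial>M)
      = (\<integral>\<^sup>+\<omega>. liminf (\<lambda>k. ennreal (\<bar>W k \<omega>\<bar> powr u)) \<partial>M)"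
  proof (intro nn_integral_cong)
    fix \<omega> assume "\<omega> \<in> space M"
    then have "(\<lambda>k. ennreal (\<bar>W k \<omega>\<bar> powr u)) \<longlonglongrightarrow> ennreal (\<bar>Z \<omega>\<bar> powr u)"
      using lim u by (intro tendsto_ennrealI tendsto_powr2 tendsto_rabs tendsto_const) auto
    then show "ennreal (\<bar>Z \<omega>\<bar> powr u) = liminf (\<lambda>k. ennreal (\<bar>W k \<omega>\<bar> powr u))"
      using lim_imp_Liminf[OF sequentially_bot] by metis
  qed
  also have "\<dots> \<le> liminf (\<lambda>k. \<integral>\<^sup>+\<omega>. ennreal (\<bar>W k \<omega>\<bar> powr u) \<partial>M)"
    by (intro nn_integral_liminf) simp
  also have "\<dots> \<le> liminf (\<lambda>k::nat. ennreal ((B * \<psi> u) powr u))"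
    using W u by (intro Liminf_mono always_eventually allI) (auto simp: moment_bound_def)
  finally show "(\<integral>\<^sup>+\<omega>. ennreal (\<bar>Z \<omega>\<bar> powr u) \<partial>M) \<le> ennreal ((B * \<psi> u) powr u)"
    by (simp add: Liminf_const)
qed

lemma psi_space_diff:
  assumes "psi_function \<psi>" "X \<in> psi_space M \<psi>" "Y \<in> psi_space M \<psi>"
  shows "(\<lambda>\<omega>. X \<omega> - Y \<omega>) \<in> psi_space M \<psi>"
proof -
  have "moment_bound M \<psi> (psi_norm M \<psi> X + \<bar>-1\<bar> * psi_norm M \<psi> Y) (\<lambda>\<omega>. X \<omega> + (-1) * Y \<omega>)"
    using assms
    by (intro moment_bound_add moment_bound_cmult moment_bound_psi_norm) (auto intro: psi_norm_nonneg)
  then show ?thesis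
    using moment_bound_iff[OF assms(1), of "psi_norm M \<psi> X + psi_norm M \<psi> Y" M "\<lambda>\<omega>. X \<omega> - Y \<omega>"]
      psi_norm_nonneg[OF assms(1,2)] psi_norm_nonneg[OF assms(1,3)]
    by simp
qed

lemma moment_bound_distr:
  assumes "Y \<in> measurable M N" "moment_bound (distr M N Y) \<psi> B g"
  shows "moment_bound M \<psi> B (\<lambda>\<omega>. g (Y \<omega>))"
proof -
  have [measurable]: "Y \<in> measurable M N" "g \<in> borel_measurable N"
    using assms by (auto simp: moment_bound_def)
  show ?thesis
    using assms by (simp add: moment_bound_def nn_integral_distr)
qed

lemma moment_bound_integrable:
  assumes "moment_bound M \<psi> B X"
  shows "integrable M X"
proof (rule integrableI_bounded)
  show "X \<in> borel_measurable M" using assms by (simp add: moment_bound_def)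
  have "(\<integral>\<^sup>+\<omega>. ennreal (\<bar>X \<omega>\<bar> powr 1) \<partial>M) \<le> ennreal ((B * \<psi> 1) powr 1)"
    using assms unfolding moment_bound_def by blast
  then show "(\<integral>\<^sup>+\<omega>. ennreal (norm (X \<omega>)) \<partial>M) < \<infinity>"
    using le_less_trans[OF _ ennreal_less_top] by simp
qed

text \<open>
  Among all moments only \<open>u = 1\<close> enters here. The bound controls the mean both when a variable is centred
  and when the continuity of the mean in the parameter is derived.
\<close>

lemma moment_bound_abs_integral_le:
  assumes "psi_function \<psi>" "moment_bound M \<psi> B X" "0 \<le> B"
  shows "\<bar>\<integral>\<omega>. X \<omega> \<partial>M\<bar> \<le> B * \<psi> 1"
proof -
  have pos: "0 < \<psi> 1" using psi_function_pos[OF assms(1)] by simp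
  have "(\<integral>\<^sup>+\<omega>. ennreal (\<bar>X \<omega>\<bar> powr 1) \<partial>M) \<le> ennreal ((B * \<psi> 1) powr 1)"
    using assms(2) unfolding moment_bound_def by blast
  then have "(\<integral>\<^sup>+\<omega>. ennreal (norm (X \<omega>)) \<partial>M) \<le> ennreal (B * \<psi> 1)"
    using assms(3) pos by simp
  with integral_norm_bound_ennreal[OF moment_bound_integrable[OF assms(2)]]
  have "ennreal \<bar>\<integral>\<omega>. X \<omega> \<partial>M\<bar> \<le> ennreal (B * \<psi> 1)"
    by (simp add: order_trans)
  then show ?thesis
    using assms(3) pos by simp
qed

text \<open>
  This is the origin of the factor 2 in the final constant: the mean, as a constant function, has
  norm at most \<open>B\<close>, so centring at most doubles the bound.
\<close>

lemma moment_bound_center: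
  assumes M: "prob_space M" and \<psi>: "psi_function \<psi>" and X: "moment_bound M \<psi> B X" and B: "0 \<le> B"
  shows "moment_bound M \<psi> (2 * B) (\<lambda>\<omega>. X \<omega> - (\<integral>\<omega>. X \<omega> \<partial>M))"
proof -
  let ?m = "\<integral>\<omega>. X \<omega> \<partial>M"
  have pos: "0 < \<psi> 1" using psi_function_pos[OF \<psi>] by simp
  then have "\<bar>- ?m\<bar> / \<psi> 1 \<le> B"
    using moment_bound_abs_integral_le[OF \<psi> X B] by (simp add: pos_divide_le_eq)
  then have "moment_bound M \<psi> B (\<lambda>_. - ?m)"
    using pos by (auto intro!: moment_bound_mono[OF \<psi> moment_bound_const[OF M \<psi>]])
  from moment_bound_add[OF \<psi> X this B B] show ?thesis by simp
qed

lemma moment_bound_tail: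
  assumes M: "prob_space M" and X: "moment_bound M \<psi> B X"
    and "1 \<le> u" "0 < \<epsilon>"
  shows "measure M {\<omega> \<in> space M. \<epsilon> \<le> X \<omega>} \<le> (B * \<psi> u) powr u / \<epsilon> powr u"
proof -
  interpret prob_space M by fact
  have [measurable]: "X \<in> borel_measurable M" using X by (simp add: moment_bound_def)
  have "emeasure M {\<omega> \<in> space M. \<epsilon> \<le> X \<omega>}
      \<le> emeasure M {\<omega> \<in> space M. 1 \<le> ennreal (1 / \<epsilon> powr u) * ennreal (\<bar>X \<omega>\<bar> powr u)}"
  proof (intro emeasure_mono subsetI)
    fix \<omega> assume "\<omega> \<in> {\<omega> \<in> space M. \<epsilon> \<le> X \<omega>}"
    then have "\<omega> \<in> space M" "\<epsilon> powr u \<le> \<bar>X \<omega>\<bar> powr u"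
      using assms by (auto intro: powr_mono2)
    then show "\<omega> \<in> {\<omega> \<in> space M. 1 \<le> ennreal (1 / \<epsilon> powr u) * ennreal (\<bar>X \<omega>\<bar> powr u)}"
      using assms by (simp flip: ennreal_mult ennreal_1 add: pos_le_divide_eq)
  qed measurable
  also have "\<dots> \<le> ennreal (1 / \<epsilon> powr u) * (\<integral>\<^sup>+\<omega>. ennreal (\<bar>X \<omega>\<bar> powr u) * indicator (space M) \<omega> \<partial>M)"
    using nn_integral_Markov_inequality[of "\<lambda>\<omega>. ennreal (\<bar>X \<omega>\<bar> powr u)" "space M" M "ennreal (1 / \<epsilon> powr u)"]
    by (simp)
  also have "(\<integral>\<^sup>+\<omega>. ennreal (\<bar>X \<omega>\<bar> powr u) * indicator (space M) \<omega> \<partial>M) = (\<integral>\<^sup>+\<omega>. ennreal (\<bar>X \<omega>\<bar> powr u) \<partial>M)"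
    by (intro nn_integral_cong) auto
  also have "ennreal (1 / \<epsilon> powr u) * (\<integral>\<^sup>+\<omega>. ennreal (\<bar>X \<omega>\<bar> powr u) \<partial>M)
      \<le> ennreal (1 / \<epsilon> powr u) * ennreal ((B * \<psi> u) powr u)"
    using X assms by (intro mult_left_mono) (auto simp: moment_bound_def)
  finally show ?thesis
    by (simp add: emeasure_eq_measure flip: ennreal_mult)
qed

section \<open>Maxima and chaining over finite nets\<close>

lemma majorizing_characteristicD:
  assumes "majorizing_characteristic M \<psi> \<kappa>" "1 \<le> n" "\<And>i. i \<in> {1..n} \<Longrightarrow> \<xi> i \<in> psi_space M \<psi>"
  shows "psi_norm M \<psi> (\<lambda>\<omega>. MAX i\<in>{1..n}. \<bar>\<xi> i \<omega>\<bar>) \<le> \<kappa> n * (MAX i\<in>{1..n}. psi_norm M \<psi> (\<xi> i))"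
  using assms by (simp add: majorizing_characteristic_def)

text \<open>
  Follows from the defining inequality for \<open>n\<close> copies of the constant \<open>1\<close>, whose norm is positive.
  Hence all terms of the chaining sum are nonnegative.
\<close>

lemma majorizing_characteristic_ge_1:
  assumes M: "prob_space M" and \<psi>: "psi_function \<psi>" and \<kappa>: "majorizing_characteristic M \<psi> \<kappa>"
    and "1 \<le> n"
  shows "1 \<le> \<kappa> n"
proof -
  let ?one = "\<lambda>_::'a. 1::real"
  have one: "?one \<in> psi_space M \<psi>"
    by (rule psi_norm_le(1)[OF \<psi> _ moment_bound_const[OF M \<psi>]])
      (use psi_function_pos[OF \<psi>, of 1] in simp)
  have "psi_norm M \<psi> ?one \<noteq> 0"
  proof
    assume "psi_norm M \<psi> ?one = 0"
    then have "moment_bound M \<psi> 0 ?one"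
      using moment_bound_psi_norm[OF \<psi> one] by simp
    then have "(\<integral>\<^sup>+\<omega>. ennreal (\<bar>1\<bar> powr 1) \<partial>M) \<le> ennreal ((0 * \<psi> 1) powr 1)"
      unfolding moment_bound_def by blast
    then show False
      using prob_space.emeasure_space_1[OF M] by simp
  qed
  then have pos: "0 < psi_norm M \<psi> ?one"
    using psi_norm_nonneg[OF \<psi> one] by simp
  have const: "(\<lambda>_. c) ` {1..n} = {c}" for c :: real
    using \<open>1 \<le> n\<close> by auto
  have "psi_norm M \<psi> (\<lambda>\<omega>. MAX i\<in>{1..n}. \<bar>?one \<omega>\<bar>) \<le> \<kappa> n * (MAX i\<in>{1..n}. psi_norm M \<psi> ?one)"
    by (rule majorizing_characteristicD[OF \<kappa> \<open>1 \<le> n\<close> one])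
  then have "psi_norm M \<psi> ?one \<le> \<kappa> n * psi_norm M \<psi> ?one"
    unfolding const by simp
  then show ?thesis using pos by simp
qed

text \<open>
  The defining inequality of \<open>\<kappa>\<close> for an arbitrary finite index set, with the membership of the maximum in the
  space added: the maximum is dominated by the sum, whose moments are finite by the triangle inequality.
\<close>

lemma moment_bound_Max:
  assumes M: "prob_space M" and \<psi>: "psi_function \<psi>" and \<kappa>: "majorizing_characteristic M \<psi> \<kappa>"
    and V: "finite V" "V \<noteq> {}" "card V \<le> N"
    and Y: "\<And>t. t \<in> V \<Longrightarrow> Y t \<in> psi_space M \<psi>" "\<And>t. t \<in> V \<Longrightarrow> psi_norm M \<psi> (Y t) \<le> b"
  shows "moment_bound M \<psi> (\<kappa> N * b) (\<lambda>\<omega>. MAX t\<in>V. \<bar>Y t \<omega>\<bar>)"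
proof -
  let ?m = "card V"
  let ?Z = "\<lambda>\<omega>. MAX t\<in>V. \<bar>Y t \<omega>\<bar>"
  have m: "1 \<le> ?m" using V by (simp add: Suc_leI card_gt_0_iff)
  obtain g where g: "bij_betw g {1..?m} V"
    using ex_bij_betw_nat_finite_1[OF V(1)] by blast
  have image: "(\<lambda>i. F (g i)) ` {1..?m} = F ` V" for F :: "_ \<Rightarrow> real"
    using bij_betw_imp_surj_on[OF g] by (metis image_image)
  have [measurable]: "Y t \<in> borel_measurable M" if "t \<in> V" for t
    using Y(1)[OF that] by (simp add: psi_space_def)
  have norm: "0 \<le> psi_norm M \<psi> (Y t)" if "t \<in> V" for t
    using psi_norm_nonneg[OF \<psi> Y(1)[OF that]] .
  have b: "0 \<le> b" using V(2) norm Y(2) by fastforce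
  have "moment_bound M \<psi> (\<Sum>t\<in>V. psi_norm M \<psi> (Y t)) (\<lambda>\<omega>. \<Sum>t\<in>V. \<bar>Y t \<omega>\<bar>)"
  proof (rule moment_bound_sum[OF \<psi> V(1)])
    fix t assume t: "t \<in> V"
    then show "moment_bound M \<psi> (psi_norm M \<psi> (Y t)) (\<lambda>\<omega>. \<bar>Y t \<omega>\<bar>)"
      by (intro moment_bound_dominated[OF moment_bound_psi_norm[OF \<psi> Y(1)[OF t]]]) auto
  qed (rule norm)
  then have "moment_bound M \<psi> (\<Sum>t\<in>V. psi_norm M \<psi> (Y t)) ?Z"
  proof (rule moment_bound_dominated)
    show "?Z \<in> borel_measurable M" using V(1) by measurable
    fix \<omega>
    have "?Z \<omega> \<in> (\<lambda>t. \<bar>Y t \<omega>\<bar>) ` V" using V by (intro Max_in) auto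
    then obtain t where t: "t \<in> V" "?Z \<omega> = \<bar>Y t \<omega>\<bar>" by auto
    have "\<bar>Y t \<omega>\<bar> \<le> (\<Sum>t\<in>V. \<bar>Y t \<omega>\<bar>)"
      using member_le_sum[OF t(1), of "\<lambda>t. \<bar>Y t \<omega>\<bar>"] V(1) by simp
    then show "\<bar>?Z \<omega>\<bar> \<le> \<bar>\<Sum>t\<in>V. \<bar>Y t \<omega>\<bar>\<bar>" using t(2) by simp
  qed
  then have Z: "?Z \<in> psi_space M \<psi>"
    using moment_bound_iff[OF \<psi> sum_nonneg[of V "\<lambda>t. psi_norm M \<psi> (Y t)", OF norm]] by blast
  have "Y (g i) \<in> psi_space M \<psi>" if "i \<in> {1..?m}" for i
    using bij_betwE[OF g] Y(1) that by blast
  then have "psi_norm M \<psi> (\<lambda>\<omega>. MAX i\<in>{1..?m}. \<bar>Y (g i) \<omega>\<bar>)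
      \<le> \<kappa> ?m * (MAX i\<in>{1..?m}. psi_norm M \<psi> (Y (g i)))"
    by (rule majorizing_characteristicD[OF \<kappa> m])
  then have "psi_norm M \<psi> ?Z \<le> \<kappa> ?m * (MAX t\<in>V. psi_norm M \<psi> (Y t))"
    unfolding image[of "\<lambda>t. \<bar>Y t _\<bar>"] image[of "\<lambda>t. psi_norm M \<psi> (Y t)"] .
  also have "\<dots> \<le> \<kappa> N * b"
  proof (rule mult_mono)
    show "\<kappa> ?m \<le> \<kappa> N"
      using \<kappa> m V(3) by (auto simp: majorizing_characteristic_def mono_on_def)
    show "(MAX t\<in>V. psi_norm M \<psi> (Y t)) \<le> b"
      using V Y(2) by simp
    show "0 \<le> (MAX t\<in>V. psi_norm M \<psi> (Y t))"
      using V norm by (auto simp: Max_ge_iff)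
    show "0 \<le> \<kappa> N"
      using majorizing_characteristic_ge_1[OF M \<psi> \<kappa>, of N] m V(3) by simp
  qed
  finally have le: "psi_norm M \<psi> ?Z \<le> \<kappa> N * b" .
  have "0 \<le> \<kappa> N * b"
    using majorizing_characteristic_ge_1[OF M \<psi> \<kappa>, of N] m V(3) b by simp
  then show ?thesis
    using moment_bound_iff[OF \<psi>] Z le by blast
qed

text \<open>
  The maximum over \<open>T\<close> is attained at some point, and points of the nets converge to it.
  Thus the supremum over the possibly uncountable set \<open>T\<close> is a limit of finite maxima; this yields its
  measurability as well as its norm.
\<close>

lemma Max_nets_tendsto_Sup:
  fixes g :: "'t::metric_space \<Rightarrow> real"
  assumes T: "compact T" "T \<noteq> {}" and g: "continuous_on T g"
    and V: "\<And>k. finite (V k)" "\<And>k. V k \<subseteq> T" "\<And>k t. t \<in> T \<Longrightarrow> \<exists>v\<in>V k. dist t v \<le> h k"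
    and h: "h \<longlonglongrightarrow> 0"
  shows "(\<lambda>k. MAX t\<in>V k. g t) \<longlonglongrightarrow> (SUP t\<in>T. g t)"
proof -
  obtain t where t: "t \<in> T" "\<And>s. s \<in> T \<Longrightarrow> g s \<le> g t"
    using continuous_attains_sup[OF T g] by blast
  have Sup: "(SUP t\<in>T. g t) = g t"
    using t by (intro cSup_eq_maximum) auto
  obtain v where v: "\<And>k. v k \<in> V k" "\<And>k. dist t (v k) \<le> h k"
    using V(3)[OF t(1)] by metis
  have "v \<longlonglongrightarrow> t"
  proof (rule metric_tendsto_imp_tendsto[OF h])
    show "\<forall>\<^sub>F k in sequentially. dist (v k) t \<le> dist (h k) 0"
      using v(2) by (intro always_eventually allI) (metis abs_ge_self dist_commute dist_real_def diff_0_right order_trans)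
  qed
  then have lim: "(\<lambda>k. g (v k)) \<longlonglongrightarrow> g t"
    using v(1) V(2) t(1)
    by (intro continuous_on_tendsto_compose[OF g] always_eventually allI) blast+
  show ?thesis
    unfolding Sup
  proof (rule tendsto_sandwich[OF _ _ lim tendsto_const])
    show "\<forall>\<^sub>F k in sequentially. g (v k) \<le> (MAX t\<in>V k. g t)"
      using v(1) V(1) by (intro always_eventually allI Max_ge) auto
    show "\<forall>\<^sub>F k in sequentially. (MAX t\<in>V k. g t) \<le> g t"
    proof (intro always_eventually allI Max.boundedI)
      show "g ` V k \<noteq> {}" for k using v(1) by blast
      show "x \<le> g t" if "x \<in> g ` V k" for k x using that V(2) t(2) by blast
    qed (use V in auto)
  qed
qed

text \<open>
  The chaining argument. Sending each point of the net \<open>V (Suc k)\<close> to a point of \<open>V k\<close> within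
  distance \<open>h k\<close> changes the process by a variable of norm at most \<open>e k\<close>. There are at most \<open>N (Suc k)\<close>
  such changes, so passing from \<open>V k\<close> to \<open>V (Suc k)\<close> raises the bound for the maximum by
  \<open>\<kappa> (N (Suc k)) * e k\<close>. The chain starts at the single point \<open>t0\<close>, and Fatou's lemma ends it.
\<close>

lemma moment_bound_Sup_chaining:
  fixes T :: "'t::metric_space set"
  assumes M: "prob_space M" and \<psi>: "psi_function \<psi>" and \<kappa>: "majorizing_characteristic M \<psi> \<kappa>"
    and T: "compact T" "T \<noteq> {}"
    and X: "\<And>t. t \<in> T \<Longrightarrow> X t \<in> psi_space M \<psi>"
    and cont: "\<And>\<omega>. \<omega> \<in> space M \<Longrightarrow> continuous_on T (\<lambda>t. X t \<omega>)"
    and inc: "\<And>k t t'. t \<in> T \<Longrightarrow> t' \<in> T \<Longrightarrow> dist t t' \<le> h k \<Longrightarrow>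
      psi_norm M \<psi> (\<lambda>\<omega>. X t \<omega> - X t' \<omega>) \<le> e k"
    and V0: "V 0 = {t0}"
    and V: "\<And>k. finite (V k)" "\<And>k. V k \<subseteq> T" "\<And>k t. t \<in> T \<Longrightarrow> \<exists>v\<in>V k. dist t v \<le> h k"
    and N: "\<And>k. card (V (Suc k)) \<le> N (Suc k)"
    and h: "h \<longlonglongrightarrow> 0" and e: "\<And>k. 0 \<le> e k"
    and J: "\<And>k. (\<Sum>j<k. \<kappa> (N (Suc j)) * e j) \<le> J"
  shows "moment_bound M \<psi> (psi_norm M \<psi> (X t0) + J) (\<lambda>\<omega>. SUP t\<in>T. \<bar>X t \<omega>\<bar>)"
proof -
  have t0: "t0 \<in> T" using V(2)[of 0] V0 by simp
  have ne: "V k \<noteq> {}" for k using V(3)[OF t0] by blast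
  have [measurable]: "X t \<in> borel_measurable M" if "t \<in> T" for t
    using X[OF that] by (simp add: psi_space_def)
  have N_pos: "1 \<le> N (Suc k)" for k
  proof -
    have "0 < card (V (Suc k))" using ne[of "Suc k"] V(1)[of "Suc k"] by (simp add: card_gt_0_iff)
    then show ?thesis using N[of k] by linarith
  qed
  have term_nonneg: "0 \<le> \<kappa> (N (Suc k)) * e k" for k
    using majorizing_characteristic_ge_1[OF M \<psi> \<kappa> N_pos[of k]] e[of k] by simp
  let ?W = "\<lambda>k \<omega>. MAX t\<in>V k. \<bar>X t \<omega>\<bar>"
  let ?b = "\<lambda>k. psi_norm M \<psi> (X t0) + (\<Sum>j<k. \<kappa> (N (Suc j)) * e j)"
  have b_nonneg: "0 \<le> ?b k" for k
    using psi_norm_nonneg[OF \<psi> X[OF t0]] term_nonneg by (simp add: sum_nonneg)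
  have meas: "?W k \<in> borel_measurable M" for k
    using V(1,2)[of k] by (intro borel_measurable_Max) auto
  have step: "moment_bound M \<psi> (?b k) (?W k)" for k
  proof (induction k)
    case 0
    have "moment_bound M \<psi> (?b 0) (X t0)"
      using moment_bound_psi_norm[OF \<psi> X[OF t0]] by simp
    then show ?case
      by (rule moment_bound_dominated[OF _ meas]) (simp add: V0)
  next
    case (Suc k)
    obtain a where a: "\<And>t. t \<in> T \<Longrightarrow> a t \<in> V k" "\<And>t. t \<in> T \<Longrightarrow> dist t (a t) \<le> h k"
      using V(3)[of _ k] by metis
    let ?D = "\<lambda>\<omega>. MAX t\<in>V (Suc k). \<bar>X t \<omega> - X (a t) \<omega>\<bar>"
    have sub: "t \<in> T" "a t \<in> T" if "t \<in> V (Suc k)" for t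
      using V(2) that a(1) by blast+
    have "moment_bound M \<psi> (\<kappa> (N (Suc k)) * e k) ?D"
      using sub a(2) by (intro moment_bound_Max[OF M \<psi> \<kappa> V(1) ne N] psi_space_diff[OF \<psi>] X inc) auto
    from moment_bound_add[OF \<psi> Suc this b_nonneg term_nonneg]
    have "moment_bound M \<psi> (?b (Suc k)) (\<lambda>\<omega>. ?W k \<omega> + ?D \<omega>)"
      by (simp add: add.assoc)
    then show ?case
    proof (rule moment_bound_dominated[OF _ meas])
      fix \<omega>
      have "?W (Suc k) \<omega> \<in> (\<lambda>t. \<bar>X t \<omega>\<bar>) ` V (Suc k)"
        using V(1) ne by (intro Max_in) auto
      then obtain t where t: "t \<in> V (Suc k)" "?W (Suc k) \<omega> = \<bar>X t \<omega>\<bar>" by auto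
      have "\<bar>X (a t) \<omega>\<bar> \<le> ?W k \<omega>"
        using a(1)[OF sub(1)[OF t(1)]] V(1) by (intro Max_ge) auto
      moreover have "\<bar>X t \<omega> - X (a t) \<omega>\<bar> \<le> ?D \<omega>"
        using t(1) V(1) by (intro Max_ge) auto
      ultimately show "\<bar>?W (Suc k) \<omega>\<bar> \<le> \<bar>?W k \<omega> + ?D \<omega>\<bar>"
        unfolding t(2) by linarith
    qed
  qed
  show ?thesis
  proof (rule moment_bound_LIMSEQ)
    show "moment_bound M \<psi> (psi_norm M \<psi> (X t0) + J) (?W k)" for k
      using J by (intro moment_bound_mono[OF \<psi> step b_nonneg]) simp
    show "(\<lambda>k. ?W k \<omega>) \<longlonglongrightarrow> (SUP t\<in>T. \<bar>X t \<omega>\<bar>)" if "\<omega> \<in> space M" for \<omega>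
      using cont[OF that] by (intro Max_nets_tendsto_Sup[OF T _ V h] continuous_on_rabs)
  qed
qed

section \<open>Metric massiveness and the entropy integral\<close>

text \<open>
  Comparison with the integral over the cells \<open>[g p\<^sup>j\<^sup>+\<^sup>1, g p\<^sup>j)\<close>: such a cell has length \<open>(1 - p) g p\<^sup>j\<close>, and
  on it the decreasing function \<open>F\<close> is at least its value at the right end.
\<close>

lemma geometric_sum_le_integral:
  fixes F :: "real \<Rightarrow> real"
  assumes p: "0 < p" "p < 1" and g: "0 < g"
    and anti: "\<And>u v. 0 < u \<Longrightarrow> u \<le> v \<Longrightarrow> v \<le> g \<Longrightarrow> F v \<le> F u"
    and F_nonneg: "\<And>u. 0 < u \<Longrightarrow> u \<le> g \<Longrightarrow> 0 \<le> F u"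
    and int: "set_integrable lborel {0<..<g} F"
  shows "(\<Sum>j<k. F (g * p ^ j) * (g * p ^ j)) \<le> 1 / (1 - p) * (LBINT u:{0<..<g}. F u)"
proof -
  let ?q = "\<lambda>j. g * p ^ j"
  have q_pos: "0 < ?q j" for j using p g by simp
  have q_Suc: "?q (Suc j) \<le> ?q j" for j using p g by (simp add: mult_left_le_one_le)
  have q_le: "?q j \<le> g" for j using p g by (simp add: power_le_one)
  have sub: "set_integrable lborel {?q j..<b} F" if "b \<le> g" for j b
    using that q_pos[of j] by (intro set_integrable_subset[OF int]) auto
  have cell: "F (?q j) * (?q j - ?q (Suc j)) \<le> (LBINT u:{?q (Suc j)..<?q j}. F u)" for j
  proof -
    have "(LBINT u:{?q (Suc j)..<?q j}. F (?q j)) \<le> (LBINT u:{?q (Suc j)..<?q j}. F u)"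
    proof (rule set_integral_mono)
      show "set_integrable lborel {?q (Suc j)..<?q j} (\<lambda>u. F (?q j))"
        unfolding set_integrable_def
        using q_Suc[of j] by (intro integrable_scaleR_left integrable_real_indicator)
          (simp_all only: emeasure_lborel_Ico, simp_all)
      show "F (?q j) \<le> F u" if "u \<in> {?q (Suc j)..<?q j}" for u
        using that q_pos[of "Suc j"] q_le[of j] by (intro anti) auto
    qed (rule sub[OF q_le])
    then show ?thesis
      using q_Suc[of j] by (simp add: set_integral_const mult.commute)
  qed
  have "(\<Sum>j<k. F (?q j) * (?q j - ?q (Suc j))) \<le> (LBINT u:{?q k..<g}. F u)"
  proof (induction k)
    case (Suc k)
    have split: "{?q (Suc k)..<g} = {?q (Suc k)..<?q k} \<union> {?q k..<g}"
      using q_Suc[of k] q_le[of k] by auto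
    have "(LBINT u:{?q (Suc k)..<g}. F u)
        = (LBINT u:{?q (Suc k)..<?q k}. F u) + (LBINT u:{?q k..<g}. F u)"
      unfolding split by (intro set_integral_Un sub q_le) auto
    then show ?case using Suc cell[of k] by simp
  qed (simp add: set_lebesgue_integral_def)
  also have "\<dots> \<le> (LBINT u:{0<..<g}. F u)"
    unfolding set_lebesgue_integral_def
  proof (rule integral_mono)
    show "integrable lborel (\<lambda>u. indicator {?q k..<g} u *\<^sub>R F u)"
      using sub[of g k] by (simp add: set_integrable_def)
    show "integrable lborel (\<lambda>u. indicator {0<..<g} u *\<^sub>R F u)"
      using int by (simp add: set_integrable_def)
    show "indicator {?q k..<g} u *\<^sub>R F u \<le> indicator {0<..<g} u *\<^sub>R F u" for u
      using F_nonneg[of u] q_pos[of k] by (auto split: split_indicator)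
  qed
  finally have "(1 - p) * (\<Sum>j<k. F (?q j) * ?q j) \<le> (LBINT u:{0<..<g}. F u)"
    by (simp add: sum_distrib_left algebra_simps)
  then show ?thesis using p by (simp add: field_simps)
qed

text \<open>
  The property whose least solution is the metric massiveness, named so that \<open>LeastI\<close> and
  \<open>Least_le\<close> can be applied to it.
\<close>

definition covered_by_balls :: "'t::metric_space set \<Rightarrow> real \<Rightarrow> nat \<Rightarrow> bool" where
  "covered_by_balls T u n \<longleftrightarrow> (\<exists>(c :: nat \<Rightarrow> 't) (r :: nat \<Rightarrow> real).
     (\<forall>i<n. c i \<in> T \<and> 0 \<le> r i \<and> r i \<le> u) \<and> T \<subseteq> (\<Union>i<n. cball (c i) (r i)))"

lemma massiveness_Least: "massiveness T u = (LEAST n. covered_by_balls T u n)"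
  by (simp add: massiveness_def covered_by_balls_def)

text \<open>
  The minimum in the definition of the massiveness is attained: compactness provides some finite cover.
\<close>

lemma covered_by_balls_massiveness:
  assumes "compact T" "0 < u"
  shows "covered_by_balls T u (massiveness T u)"
proof -
  obtain C where C: "C \<subseteq> T" "finite C" "T \<subseteq> (\<Union>c\<in>C. ball c u)"
  proof (rule compactE_image[OF assms(1), of T "\<lambda>c. ball c u"])
    show "T \<subseteq> (\<Union>c\<in>T. ball c u)" using assms(2) by auto
  qed auto
  obtain c where c: "bij_betw c {0..<card C} C"
    using ex_bij_betw_nat_finite[OF C(2)] by blast
  have img: "c ` {..<card C} = C"
    using bij_betw_imp_surj_on[OF c] by (simp add: atLeast0LessThan)
  have "covered_by_balls T u (card C)"
    unfolding covered_by_balls_def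
  proof (intro exI[of _ c] exI[of _ "\<lambda>_. u"] conjI allI impI)
    show "c i \<in> T" if "i < card C" for i using img C(1) that by blast
    show "T \<subseteq> (\<Union>i<card C. cball (c i) u)"
    proof
      fix t assume "t \<in> T"
      then obtain x where x: "x \<in> C" "dist x t < u" using C(3) by auto
      then obtain i where "i < card C" "x = c i" using img by auto
      with x show "t \<in> (\<Union>i<card C. cball (c i) u)" by force
    qed
  qed (use assms(2) in auto)
  then show ?thesis
    unfolding massiveness_Least by (rule LeastI)
qed

lemma massiveness_net:
  assumes "compact T" "0 < u"
  obtains V where "finite V" "V \<subseteq> T" "card V \<le> massiveness T u" "\<And>t. t \<in> T \<Longrightarrow> \<exists>v\<in>V. dist t v \<le> u"
proof -
  obtain c r where c: "\<And>i. i < massiveness T u \<Longrightarrow> c i \<in> T \<and> 0 \<le> r i \<and> r i \<le> u"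
    and cover: "T \<subseteq> (\<Union>i<massiveness T u. cball (c i) (r i))"
    using covered_by_balls_massiveness[OF assms] unfolding covered_by_balls_def by metis
  show thesis
  proof (rule that[of "c ` {..<massiveness T u}"])
    show "card (c ` {..<massiveness T u}) \<le> massiveness T u"
      using card_image_le[of "{..<massiveness T u}" c] by simp
    show "\<exists>v\<in>c ` {..<massiveness T u}. dist t v \<le> u" if t: "t \<in> T" for t
    proof -
      obtain i where "i < massiveness T u" "dist (c i) t \<le> r i"
        using subsetD[OF cover t] by auto
      then show ?thesis using c[of i] by (force simp: dist_commute)
    qed
  qed (use c in auto)
qed

lemma massiveness_antimono:
  assumes "compact T" "0 < u" "u \<le> v"
  shows "massiveness T v \<le> massiveness T u"
proof -
  have "covered_by_balls T v (massiveness T u)"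
    using covered_by_balls_massiveness[OF assms(1,2)] assms(3)
    unfolding covered_by_balls_def by (meson order_trans)
  then show ?thesis
    unfolding massiveness_Least[of T v] by (rule Least_le)
qed

lemma massiveness_ge_1:
  assumes "compact T" "T \<noteq> {}" "0 < u"
  shows "1 \<le> massiveness T u"
  using covered_by_balls_massiveness[OF assms(1,3)] assms(2)
  by (cases "massiveness T u") (auto simp: covered_by_balls_def)

text \<open>
  Every value between \<open>0\<close> and \<open>\<sigma> d\<close> is taken by the intermediate value theorem; outside the range of
  \<open>\<sigma>\<close> the inverse function is unspecified.
\<close>

lemma inverse_fun_props:
  fixes \<sigma> :: "real \<Rightarrow> real"
  assumes "continuous_on {0..} \<sigma>" "strict_mono_on {0..} \<sigma>" "\<sigma> 0 = 0" "0 \<le> d" "0 \<le> y" "y \<le> \<sigma> d"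
  shows "0 \<le> inverse_fun \<sigma> y" "inverse_fun \<sigma> y \<le> d" "\<sigma> (inverse_fun \<sigma> y) = y"
proof -
  obtain x where x: "0 \<le> x" "x \<le> d" "\<sigma> x = y"
    using IVT'[of \<sigma> 0 y d] assms continuous_on_subset[OF assms(1), of "{0..d}"] by auto
  have "inverse_fun \<sigma> y = x"
    using the_inv_into_f_eq[OF strict_mono_on_imp_inj_on[OF assms(2)] x(3)] x(1) by simp
  with x show "0 \<le> inverse_fun \<sigma> y" "inverse_fun \<sigma> y \<le> d" "\<sigma> (inverse_fun \<sigma> y) = y" by auto
qed

text \<open>
  The entropy bound for the supremum of a process. The radii of the nets are chosen so that the modulus
  of continuity at level \<open>k\<close> is exactly \<open>\<sigma> (diameter T) * p ^ k\<close>. At level \<open>0\<close> the radius is then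
  the diameter, so any single point is a net. The chaining sum pairs the massiveness at level
  \<open>Suc k\<close> with the modulus at level \<open>k\<close>. This mismatch costs a factor \<open>1 / p\<close>, and the
  comparison with the integral costs another factor \<open>1 / (1 - p)\<close>.
\<close>

theorem psi_norm_Sup_le_entropy_integral:
  fixes T :: "'t::metric_space set" and \<sigma> :: "real \<Rightarrow> real"
  assumes M: "prob_space M" and \<psi>: "psi_function \<psi>" and \<kappa>: "majorizing_characteristic M \<psi> \<kappa>"
    and T: "compact T" "t0 \<in> T"
    and X: "\<And>t. t \<in> T \<Longrightarrow> X t \<in> psi_space M \<psi>"
    and cont: "\<And>\<omega>. \<omega> \<in> space M \<Longrightarrow> continuous_on T (\<lambda>t. X t \<omega>)"
    and \<sigma>: "continuous_on {0..} \<sigma>" "strict_mono_on {0..} \<sigma>" "\<sigma> 0 = 0"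
    and inc: "\<And>h t t'. 0 \<le> h \<Longrightarrow> t \<in> T \<Longrightarrow> t' \<in> T \<Longrightarrow> dist t t' \<le> h \<Longrightarrow>
      psi_norm M \<psi> (\<lambda>\<omega>. X t \<omega> - X t' \<omega>) \<le> \<sigma> h"
    and p: "0 < p" "p < 1"
    and int: "set_integrable lborel {0<..<\<sigma> (diameter T) * p} (\<lambda>u. \<kappa> (massiveness T (inverse_fun \<sigma> u)))"
  shows "(\<lambda>\<omega>. SUP t\<in>T. \<bar>X t \<omega>\<bar>) \<in> psi_space M \<psi>"
    and "psi_norm M \<psi> (\<lambda>\<omega>. SUP t\<in>T. \<bar>X t \<omega>\<bar>) \<le> psi_norm M \<psi> (X t0) + 1 / (p * (1 - p)) *
      (LBINT u:{0<..<\<sigma> (diameter T) * p}. \<kappa> (massiveness T (inverse_fun \<sigma> u)))"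
proof -
  define d where "d = diameter T"
  define \<gamma> where "\<gamma> = \<sigma> d"
  define \<tau> where "\<tau> = inverse_fun \<sigma>"
  define F where "F u = \<kappa> (massiveness T (\<tau> u))" for u
  let ?J = "1 / (p * (1 - p)) * (LBINT u:{0<..<\<gamma> * p}. F u)"
  have dist_d: "dist t t' \<le> d" if "t \<in> T" "t' \<in> T" for t t'
    using diameter_bounded_bound[OF compact_imp_bounded[OF T(1)] that] by (simp add: d_def)
  have "0 \<le> d" using dist_d[OF T(2) T(2)] by simp
  have \<sigma>_mono: "\<sigma> x \<le> \<sigma> y" if "0 \<le> x" "x \<le> y" for x y
    using strict_mono_on_leD[OF \<sigma>(2)] that by simp
  have \<sigma>_pos: "0 < \<sigma> x" if "0 < x" for x
    using strict_mono_onD[OF \<sigma>(2), of 0 x] that \<sigma>(3) by simp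
  have "0 \<le> ?J \<and> moment_bound M \<psi> (psi_norm M \<psi> (X t0) + ?J) (\<lambda>\<omega>. SUP t\<in>T. \<bar>X t \<omega>\<bar>)"
  proof (cases "d = 0")
    \<comment> \<open>The supremum is the value at a single point, and the integral over an empty interval vanishes.\<close>
    case True
    then have "t = t0" if "t \<in> T" for t
      using dist_d[OF that T(2)] by simp
    then have T_eq: "T = {t0}" using T(2) by blast
    have "{0<..<\<gamma> * p} = {}" using True \<sigma>(3) by (simp add: \<gamma>_def)
    moreover have "moment_bound M \<psi> (psi_norm M \<psi> (X t0)) (\<lambda>\<omega>. \<bar>X t0 \<omega>\<bar>)"
      using X[OF T(2)]
      by (intro moment_bound_dominated[OF moment_bound_psi_norm[OF \<psi> X[OF T(2)]]]) (auto simp: psi_space_def)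
    ultimately show ?thesis by (simp add: T_eq set_lebesgue_integral_def)
  next
    case False
    then have "0 < \<gamma>" using \<open>0 \<le> d\<close> \<sigma>_pos by (simp add: \<gamma>_def)
    have \<tau>: "0 \<le> \<tau> y" "\<tau> y \<le> d" "\<sigma> (\<tau> y) = y" if "0 \<le> y" "y \<le> \<gamma>" for y
      using inverse_fun_props[OF \<sigma> \<open>0 \<le> d\<close> that(1)] that(2) by (simp_all add: \<tau>_def \<gamma>_def)
    have \<tau>_pos: "0 < \<tau> y" if "0 < y" "y \<le> \<gamma>" for y
      using \<tau>[of y] that \<sigma>(3) by (cases "\<tau> y = 0") auto
    have \<tau>_mono: "\<tau> x \<le> \<tau> y" if "0 < x" "x \<le> y" "y \<le> \<gamma>" for x y
    proof (rule ccontr)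
      assume "\<not> \<tau> x \<le> \<tau> y"
      then have "\<sigma> (\<tau> y) < \<sigma> (\<tau> x)"
        using \<tau>[of x] \<tau>[of y] that by (intro strict_mono_onD[OF \<sigma>(2)]) auto
      then show False using \<tau>[of x] \<tau>[of y] that by simp
    qed
    define e where "e k = \<gamma> * p ^ k" for k :: nat
    define h where "h k = \<tau> (e k)" for k
    have e: "0 < e k" "e k \<le> \<gamma>" for k
      using p \<open>0 < \<gamma>\<close> by (auto simp: e_def power_le_one)
    have h_pos: "0 < h k" and \<sigma>_h: "\<sigma> (h k) = e k" for k
      using e[of k] \<tau>_pos \<tau>(3) by (auto simp: h_def)
    have h_0: "h 0 = d"
    proof -
      have "\<sigma> (h 0) = \<sigma> d" using \<sigma>_h[of 0] by (simp add: e_def \<gamma>_def)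
      then show ?thesis
        using strict_mono_on_eqD[OF \<sigma>(2)] h_pos[of 0] \<open>0 \<le> d\<close> by force
    qed
    have h_lim: "h \<longlonglongrightarrow> 0"
    proof (rule LIMSEQ_I)
      fix r :: real assume "0 < r"
      have "(\<lambda>k. \<gamma> * p ^ k) \<longlonglongrightarrow> \<gamma> * 0"
        using p by (intro tendsto_mult_left LIMSEQ_realpow_zero) auto
      then have "\<forall>\<^sub>F k in sequentially. e k < \<sigma> r"
        using \<sigma>_pos[OF \<open>0 < r\<close>] by (intro order_tendstoD(2)) (simp_all add: e_def)
      then obtain K where K: "\<And>k. K \<le> k \<Longrightarrow> e k < \<sigma> r"
        unfolding eventually_sequentially by blast
      have "norm (h k - 0) < r" if "K \<le> k" for k
      proof (rule ccontr)
        assume "\<not> norm (h k - 0) < r"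
        then have "\<sigma> r \<le> \<sigma> (h k)" using \<open>0 < r\<close> h_pos[of k] by (intro \<sigma>_mono) auto
        then show False using K[OF that] \<sigma>_h[of k] by simp
      qed
      then show "\<exists>K. \<forall>k\<ge>K. norm (h k - 0) < r" by blast
    qed
    have "\<exists>V. finite V \<and> V \<subseteq> T \<and> card V \<le> massiveness T (h k) \<and> (\<forall>t\<in>T. \<exists>v\<in>V. dist t v \<le> h k)" for k
      using massiveness_net[OF T(1) h_pos[of k]] by metis
    then obtain net where net: "\<And>k. finite (net k)" "\<And>k. net k \<subseteq> T"
        "\<And>k. card (net k) \<le> massiveness T (h k)" "\<And>k t. t \<in> T \<Longrightarrow> \<exists>v\<in>net k. dist t v \<le> h k"
      by metis
    define V where "V k = (if k = 0 then {t0} else net k)" for k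
    have J: "(\<Sum>j<k. \<kappa> (massiveness T (h (Suc j))) * e j) \<le> ?J" for k
    proof -
      have int': "set_integrable lborel {0<..<\<gamma> * p} F"
        using int by (simp add: F_def[abs_def] \<tau>_def \<gamma>_def d_def)
      have le: "\<gamma> * p \<le> \<gamma>" using p \<open>0 < \<gamma>\<close> by simp
      \<comment> \<open>The radii with index at least 1 belong to arguments in \<open>(0, \<gamma> p]\<close>, hence the upper limit \<open>\<gamma> p\<close>.\<close>
      have "(\<Sum>j<k. F (\<gamma> * p * p ^ j) * (\<gamma> * p * p ^ j)) \<le> 1 / (1 - p) * (LBINT u:{0<..<\<gamma> * p}. F u)"
      proof (rule geometric_sum_le_integral[OF p _ _ _ int'])
        show "0 < \<gamma> * p" using p \<open>0 < \<gamma>\<close> by simp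
        show "0 \<le> F u" if "0 < u" "u \<le> \<gamma> * p" for u
        proof -
          have "1 \<le> massiveness T (\<tau> u)"
            using that le T by (intro massiveness_ge_1 \<tau>_pos) auto
          then show ?thesis
            using majorizing_characteristic_ge_1[OF M \<psi> \<kappa>] by (force simp: F_def)
        qed
        show "F v \<le> F u" if "0 < u" "u \<le> v" "v \<le> \<gamma> * p" for u v
        proof -
          have "massiveness T (\<tau> v) \<le> massiveness T (\<tau> u)"
            using that le by (intro massiveness_antimono[OF T(1)] \<tau>_pos \<tau>_mono) auto
          moreover have "1 \<le> massiveness T (\<tau> v)"
            using that le T by (intro massiveness_ge_1 \<tau>_pos) auto
          ultimately show ?thesis
            using \<kappa> by (auto simp: F_def majorizing_characteristic_def mono_on_def)
        qed
      qed
      moreover have "(\<Sum>j<k. F (\<gamma> * p * p ^ j) * (\<gamma> * p * p ^ j))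
          = p * (\<Sum>j<k. \<kappa> (massiveness T (h (Suc j))) * e j)"
        by (simp add: sum_distrib_left F_def h_def e_def mult_ac)
      ultimately show ?thesis
        using p by (simp add: field_simps)
    qed
    have "moment_bound M \<psi> (psi_norm M \<psi> (X t0) + ?J) (\<lambda>\<omega>. SUP t\<in>T. \<bar>X t \<omega>\<bar>)"
    proof (rule moment_bound_Sup_chaining[OF M \<psi> \<kappa> T(1) _ X cont, where h = h and e = e and V = V and N = "\<lambda>k. massiveness T (h k)"])
      show "psi_norm M \<psi> (\<lambda>\<omega>. X t \<omega> - X t' \<omega>) \<le> e k"
        if "t \<in> T" "t' \<in> T" "dist t t' \<le> h k" for k t t'
        using inc[of "h k" t t'] that h_pos[of k] \<sigma>_h[of k] by simp
      show "\<exists>v\<in>V k. dist t v \<le> h k" if "t \<in> T" for k t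
        using net(4)[OF that, of k] dist_d[OF that T(2)] h_0 by (auto simp: V_def)
      show "(\<Sum>j<k. \<kappa> (massiveness T (h (Suc j))) * e j) \<le> ?J" for k by (rule J)
    qed (use T net h_lim e in \<open>auto simp: V_def less_imp_le\<close>)
    then show ?thesis using J[of 0] by simp
  qed
  then have "(\<lambda>\<omega>. SUP t\<in>T. \<bar>X t \<omega>\<bar>) \<in> psi_space M \<psi>"
    and "psi_norm M \<psi> (\<lambda>\<omega>. SUP t\<in>T. \<bar>X t \<omega>\<bar>) \<le> psi_norm M \<psi> (X t0) + ?J"
    using psi_norm_le[OF \<psi> add_nonneg_nonneg[OF psi_norm_nonneg[OF \<psi> X[OF T(2)]]]] by blast+
  then show "(\<lambda>\<omega>. SUP t\<in>T. \<bar>X t \<omega>\<bar>) \<in> psi_space M \<psi>"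
    and "psi_norm M \<psi> (\<lambda>\<omega>. SUP t\<in>T. \<bar>X t \<omega>\<bar>) \<le> psi_norm M \<psi> (X t0) + 1 / (p * (1 - p)) *
      (LBINT u:{0<..<\<sigma> (diameter T) * p}. \<kappa> (massiveness T (inverse_fun \<sigma> u)))"
    by (simp_all add: F_def \<tau>_def \<gamma>_def d_def)
qed

section \<open>Normalized sums of independent copies\<close>

text \<open>
  Condition \<open>H\<close> turns \<open>n\<close> independent centred summands, each of norm at most \<open>2 b\<close> where \<open>b\<close> is the norm of \<open>g\<close>,
  into a sum of norm at most \<open>sqrt C * sqrt n * 2 b\<close>. Dividing by \<open>sqrt n\<close> leaves a bound that does
  not depend on \<open>n\<close>. The lemma is used both for the values and for the increments of the process.
\<close>

lemma moment_bound_normalized_sum: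
  fixes P :: "'s measure" and s :: "nat \<Rightarrow> 'w \<Rightarrow> 's"
  assumes M: "prob_space M" and \<psi>: "psi_function \<psi>" and C: "0 \<le> C" and H: "condition_H M \<psi> C"
    and n: "1 \<le> n" and indep: "prob_space.indep_vars M (\<lambda>_. P) s {1..n}"
    and distr: "\<And>i. i \<in> {1..n} \<Longrightarrow> distr M P (s i) = P"
    and g: "g \<in> psi_space P \<psi>"
  shows "moment_bound M \<psi> (2 * sqrt C * psi_norm P \<psi> g)
    (\<lambda>\<omega>. 1 / sqrt (real n) * (\<Sum>i=1..n. g (s i \<omega>) - (\<integral>x. g x \<partial>P)))"
proof -
  interpret prob_space M by fact
  define b where "b = psi_norm P \<psi> g"
  define m where "m = (\<integral>x. g x \<partial>P)"
  define \<xi> where "\<xi> i \<omega> = g (s i \<omega>) - m" for i \<omega>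
  have b: "0 \<le> b" unfolding b_def by (rule psi_norm_nonneg[OF \<psi> g])
  have gm [measurable]: "g \<in> borel_measurable P" using g by (simp add: psi_space_def)
  have s [measurable]: "s i \<in> measurable M P" if "i \<in> {1..n}" for i
    using indep that by (auto simp: indep_vars_def)
  have copy: "moment_bound M \<psi> b (\<lambda>\<omega>. g (s i \<omega>))" and mean: "(\<integral>\<omega>. g (s i \<omega>) \<partial>M) = m"
    if "i \<in> {1..n}" for i
  proof -
    show "moment_bound M \<psi> b (\<lambda>\<omega>. g (s i \<omega>))"
      using moment_bound_psi_norm[OF \<psi> g] moment_bound_distr[OF s[OF that], of \<psi> b g] distr[OF that]
      by (simp add: b_def)
    show "(\<integral>\<omega>. g (s i \<omega>) \<partial>M) = m"
      using integral_distr[OF s[OF that] gm] distr[OF that] by (simp add: m_def)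
  qed
  have \<xi>: "moment_bound M \<psi> (2 * b) (\<xi> i)" if "i \<in> {1..n}" for i
    using moment_bound_center[OF M \<psi> copy[OF that] b] by (simp add: mean[OF that] \<xi>_def[abs_def])
  have \<xi>_space: "\<xi> i \<in> psi_space M \<psi>" and \<xi>_norm: "psi_norm M \<psi> (\<xi> i) \<le> 2 * b"
    if "i \<in> {1..n}" for i
    using psi_norm_le[OF \<psi> _ \<xi>[OF that]] b by auto
  have \<xi>_mean: "(\<integral>\<omega>. \<xi> i \<omega> \<partial>M) = 0" if "i \<in> {1..n}" for i
    using moment_bound_integrable[OF copy[OF that]] by (simp add: \<xi>_def mean[OF that] prob_space)
  have \<xi>_indep: "indep_vars (\<lambda>_. borel) \<xi> {1..n}"
    unfolding \<xi>_def[abs_def] by (rule indep_vars_compose2[OF indep]) simp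
  let ?S = "\<lambda>\<omega>. \<Sum>i=1..n. \<xi> i \<omega>"
  have S: "?S \<in> psi_space M \<psi>"
    by (rule psi_norm_le(1)[OF \<psi> _ moment_bound_sum[OF \<psi> _ \<xi>]]) (use b in auto)
  have "(psi_norm M \<psi> ?S)\<^sup>2 \<le> C * (\<Sum>i=1..n. (psi_norm M \<psi> (\<xi> i))\<^sup>2)"
    using H \<xi>_space \<xi>_mean \<xi>_indep unfolding condition_H_def by blast
  also have "\<dots> \<le> C * (\<Sum>i=1..n. (2 * b)\<^sup>2)"
    using C \<xi>_norm psi_norm_nonneg[OF \<psi> \<xi>_space]
    by (intro mult_left_mono sum_mono power_mono) auto
  also have "\<dots> = (2 * sqrt C * sqrt (real n) * b)\<^sup>2"
    using C by (simp add: power_mult_distrib)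
  finally have "psi_norm M \<psi> ?S \<le> 2 * sqrt C * sqrt (real n) * b"
    by (rule power2_le_imp_le) (use C b in simp)
  then have "moment_bound M \<psi> (2 * sqrt C * sqrt (real n) * b) ?S"
    by (rule moment_bound_mono[OF \<psi> moment_bound_psi_norm[OF \<psi> S] psi_norm_nonneg[OF \<psi> S]])
  then have "moment_bound M \<psi> (\<bar>1 / sqrt (real n)\<bar> * (2 * sqrt C * sqrt (real n) * b))
      (\<lambda>\<omega>. 1 / sqrt (real n) * ?S \<omega>)"
    by (rule moment_bound_cmult[OF \<psi>]) (use C b in simp)
  then show ?thesis
    using n by (simp add: \<xi>_def b_def m_def mult.assoc)
qed

lemma inverse_fun_scaled:
  fixes \<sigma> :: "real \<Rightarrow> real"
  assumes "0 < c"
  shows "inverse_fun (\<lambda>h. c * \<sigma> h) u = inverse_fun \<sigma> (u / c)"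
proof -
  have "c * \<sigma> h = u \<longleftrightarrow> \<sigma> h = u / c" for h
    using assms by (auto simp: field_simps)
  then show ?thesis by (simp add: the_inv_into_def)
qed

text \<open>
  Together with \<open>inverse_fun_scaled\<close> this transfers the entropy condition from \<open>\<sigma>\<close> to \<open>\<sigma>\<^sub>1 = c \<sigma>\<close>.
\<close>

lemma set_integrable_scaled:
  fixes F :: "real \<Rightarrow> real"
  assumes "0 < c" "set_integrable lborel {0<..<z} F"
  shows "set_integrable lborel {0<..<c * z} (\<lambda>u. F (u / c))"
proof -
  have "integrable lborel (\<lambda>u. indicator {0<..<z} (0 + 1 / c * u) *\<^sub>R F (0 + 1 / c * u))"
    using assms by (intro lborel_integrable_real_affine) (auto simp: set_integrable_def)
  moreover have "indicator {0<..<z} (0 + 1 / c * u) = (indicator {0<..<c * z} u :: real)" for u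
    using assms(1) by (auto simp: indicator_def field_simps)
  ultimately show ?thesis by (simp add: set_integrable_def)
qed

text \<open>
  Continuity of the centred process requires continuity of the mean. As the first moment of a variable is at
  most \<open>\<psi> 1\<close> times its norm, the mean has the modulus of continuity \<open>\<psi> 1 * \<sigma>\<close>.
\<close>

lemma continuous_on_mean:
  fixes T :: "'t::metric_space set" and \<sigma> :: "real \<Rightarrow> real"
  assumes \<psi>: "psi_function \<psi>"
    and f: "\<And>t. t \<in> T \<Longrightarrow> (\<lambda>x. f x t) \<in> psi_space P \<psi>"
    and \<sigma>: "continuous_on {0..} \<sigma>" "\<sigma> 0 = 0"
    and inc: "\<And>h t t'. 0 \<le> h \<Longrightarrow> t \<in> T \<Longrightarrow> t' \<in> T \<Longrightarrow> dist t t' \<le> h \<Longrightarrow>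
      psi_norm P \<psi> (\<lambda>x. f x t - f x t') \<le> \<sigma> h"
  shows "continuous_on T (\<lambda>t. \<integral>x. f x t \<partial>P)"
  unfolding continuous_on_iff
proof (intro ballI allI impI)
  fix t and e :: real assume t: "t \<in> T" and "0 < e"
  have pos: "0 < \<psi> 1" using psi_function_pos[OF \<psi>] by simp
  then have "0 < e / \<psi> 1" using \<open>0 < e\<close> by simp
  then obtain d where d: "0 < d" "\<And>h. h \<in> {0..} \<Longrightarrow> dist h 0 < d \<Longrightarrow> dist (\<sigma> h) (\<sigma> 0) < e / \<psi> 1"
    using \<sigma>(1)[unfolded continuous_on_iff, rule_format, of 0 "e / \<psi> 1"] by auto
  have "dist (\<integral>x. f x t' \<partial>P) (\<integral>x. f x t \<partial>P) < e" if t': "t' \<in> T" "dist t' t < d" for t'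
  proof -
    have int: "integrable P (\<lambda>x. f x t)" if "t \<in> T" for t
      using moment_bound_integrable[OF moment_bound_psi_norm[OF \<psi> f[OF that]]] .
    have diff: "(\<lambda>x. f x t' - f x t) \<in> psi_space P \<psi>"
      using psi_space_diff[OF \<psi> f f] t t'(1) by blast
    have "dist (\<integral>x. f x t' \<partial>P) (\<integral>x. f x t \<partial>P) = \<bar>\<integral>x. f x t' - f x t \<partial>P\<bar>"
      using int t t'(1) by (simp add: dist_real_def)
    also have "\<dots> \<le> psi_norm P \<psi> (\<lambda>x. f x t' - f x t) * \<psi> 1"
      by (rule moment_bound_abs_integral_le[OF \<psi> moment_bound_psi_norm[OF \<psi> diff] psi_norm_nonneg[OF \<psi> diff]])
    also have "\<dots> \<le> \<sigma> (dist t' t) * \<psi> 1"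
      using inc[of "dist t' t" t' t] t t'(1) pos by (intro mult_right_mono) auto
    also have "\<dots> < e"
    proof -
      have "\<sigma> (dist t' t) < e / \<psi> 1"
        using d(2)[of "dist t' t"] t'(2) \<sigma>(2) by (simp add: dist_real_def)
      then show ?thesis using pos by (simp add: pos_less_divide_eq)
    qed
    finally show ?thesis .
  qed
  then show "\<exists>d>0. \<forall>t'\<in>T. dist t' t < d \<longrightarrow> dist (\<integral>x. f x t' \<partial>P) (\<integral>x. f x t \<partial>P) < e"
    using d(1) by blast
qed

lemma Sup_abs_cmult:
  fixes g :: "'t::topological_space \<Rightarrow> real"
  assumes "compact T" "T \<noteq> {}" "continuous_on T g" "0 \<le> c"
  shows "(SUP t\<in>T. \<bar>c * g t\<bar>) = c * (SUP t\<in>T. \<bar>g t\<bar>)"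
proof -
  obtain t where t: "t \<in> T" "\<And>s. s \<in> T \<Longrightarrow> \<bar>g s\<bar> \<le> \<bar>g t\<bar>"
    using continuous_attains_sup[OF assms(1,2) continuous_on_rabs[OF assms(3)]] by blast
  have "(SUP t\<in>T. \<bar>g t\<bar>) = \<bar>g t\<bar>"
    using t by (intro cSup_eq_maximum) auto
  moreover have "(SUP t\<in>T. \<bar>c * g t\<bar>) = \<bar>c * g t\<bar>"
    using t assms(4) by (intro cSup_eq_maximum) (auto simp: abs_mult mult_left_mono)
  ultimately show ?thesis using assms(4) by (simp add: abs_mult)
qed

text \<open>
  The entropy bound applied to \<open>X t = sqrt n * Z_centered\<close>, whose values and increments have norms at most
  \<open>2 sqrt C\<close> times those of the original process, for every \<open>n\<close>. Keeping the factor \<open>sqrt n\<close> inside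
  the supremum yields the bound \<open>B_hat / sqrt n\<close>, which the tail estimate needs. The base point of the
  chain is arbitrary, hence the infimum over \<open>T\<close> in \<open>B_hat\<close>.
\<close>

lemma moment_bound_Sup_Z_centered:
  fixes P :: "'s measure" and T :: "'t::metric_space set" and f :: "'s \<Rightarrow> 't \<Rightarrow> real"
    and M :: "'w measure" and s :: "nat \<Rightarrow> 'w \<Rightarrow> 's" and \<sigma> :: "real \<Rightarrow> real"
  assumes M: "prob_space M" and \<psi>: "psi_function \<psi>" and C: "0 < C" and H: "condition_H M \<psi> C"
    and \<kappa>: "majorizing_characteristic M \<psi> \<kappa>"
    and n: "1 \<le> n" and indep: "prob_space.indep_vars M (\<lambda>_. P) s {1..n}"
    and distr: "\<And>i. i \<in> {1..n} \<Longrightarrow> distr M P (s i) = P"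
    and T: "compact T" "T \<noteq> {}"
    and f: "\<And>t. t \<in> T \<Longrightarrow> (\<lambda>x. f x t) \<in> psi_space P \<psi>"
    and cont: "\<And>x. x \<in> space P \<Longrightarrow> continuous_on T (f x)"
    and I: "\<And>t. t \<in> T \<Longrightarrow> (\<integral>x. f x t \<partial>P) = I t"
    and \<sigma>: "continuous_on {0..} \<sigma>" "strict_mono_on {0..} \<sigma>" "\<sigma> 0 = 0"
    and inc: "\<And>h t t'. 0 \<le> h \<Longrightarrow> t \<in> T \<Longrightarrow> t' \<in> T \<Longrightarrow> dist t t' \<le> h \<Longrightarrow>
      psi_norm P \<psi> (\<lambda>x. f x t - f x t') \<le> \<sigma> h"
    and p: "0 < p" "p < 1"
    and int: "set_integrable lborel {0<..<\<sigma> (diameter T) * p} (\<lambda>u. \<kappa> (massiveness T (inverse_fun \<sigma> u)))"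
  shows "0 \<le> B_hat P \<psi> C \<kappa> \<sigma> T f p"
    and "moment_bound M \<psi> (B_hat P \<psi> C \<kappa> \<sigma> T f p / sqrt (real n))
      (\<lambda>\<omega>. SUP t\<in>T. \<bar>Z_centered f I s n \<omega> t\<bar>)"
proof -
  interpret prob_space M by fact
  define c where "c = 2 * sqrt C"
  define \<sigma>\<^sub>1 where "\<sigma>\<^sub>1 = (\<lambda>h. c * \<sigma> h)"
  define J where "J = 1 / (p * (1 - p)) *
    (LBINT u:{0<..<\<sigma>\<^sub>1 (diameter T) * p}. \<kappa> (massiveness T (inverse_fun \<sigma>\<^sub>1 u)))"
  define X where "X t \<omega> = sqrt (real n) * Z_centered f I s n \<omega> t" for t \<omega>
  let ?S = "\<lambda>\<omega>. SUP t\<in>T. \<bar>X t \<omega>\<bar>"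
  have c: "0 < c" using C by (simp add: c_def)
  have s: "s i \<in> measurable M P" if "i \<in> {1..n}" for i
    using indep that by (auto simp: indep_vars_def)
  have root: "sqrt (real n) * (1 / real n * y) = 1 / sqrt (real n) * y" for y
    using n by (simp add: field_simps)
  have X_eq: "X t = (\<lambda>\<omega>. 1 / sqrt (real n) * (\<Sum>i=1..n. f (s i \<omega>) t - (\<integral>x. f x t \<partial>P)))"
    if "t \<in> T" for t
    by (simp only: X_def Z_centered_def root I[OF that] fun_eq_iff simp_thms)
  have X_bound: "moment_bound M \<psi> (c * psi_norm P \<psi> (\<lambda>x. f x t)) (X t)" if "t \<in> T" for t
    unfolding X_eq[OF that] c_def
    using moment_bound_normalized_sum[OF M \<psi> _ H n indep distr f[OF that]] C by simp
  have norm_nonneg: "0 \<le> c * psi_norm P \<psi> (\<lambda>x. f x t)" if "t \<in> T" for t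
    using c psi_norm_nonneg[OF \<psi> f[OF that]] by simp
  have X_space: "X t \<in> psi_space M \<psi>" and X_norm: "psi_norm M \<psi> (X t) \<le> c * psi_norm P \<psi> (\<lambda>x. f x t)"
    if "t \<in> T" for t
    using psi_norm_le[OF \<psi> norm_nonneg[OF that] X_bound[OF that]] by auto
  have X_inc: "psi_norm M \<psi> (\<lambda>\<omega>. X t \<omega> - X t' \<omega>) \<le> \<sigma>\<^sub>1 h"
    if h: "0 \<le> h" and t: "t \<in> T" "t' \<in> T" and "dist t t' \<le> h" for h t t'
  proof -
    let ?g = "\<lambda>x. f x t - f x t'"
    have g: "?g \<in> psi_space P \<psi>" using psi_space_diff[OF \<psi> f f] t by blast
    have "integrable P (\<lambda>x. f x t)" "integrable P (\<lambda>x. f x t')"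
      using moment_bound_integrable[OF moment_bound_psi_norm[OF \<psi> f]] t by auto
    then have mean: "(\<integral>x. ?g x \<partial>P) = (\<integral>x. f x t \<partial>P) - (\<integral>x. f x t' \<partial>P)" by simp
    have "(\<lambda>\<omega>. X t \<omega> - X t' \<omega>) = (\<lambda>\<omega>. 1 / sqrt (real n) * (\<Sum>i=1..n. ?g (s i \<omega>) - (\<integral>x. ?g x \<partial>P)))"
      unfolding X_eq[OF t(1)] X_eq[OF t(2)] mean right_diff_distrib[symmetric] sum_subtractf[symmetric]
      by (intro ext arg_cong[where f = "\<lambda>y. 1 / sqrt (real n) * y"] sum.cong) auto
    then have "moment_bound M \<psi> (c * psi_norm P \<psi> ?g) (\<lambda>\<omega>. X t \<omega> - X t' \<omega>)"
      using moment_bound_normalized_sum[OF M \<psi> _ H n indep distr g] C by (simp add: c_def)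
    then have "psi_norm M \<psi> (\<lambda>\<omega>. X t \<omega> - X t' \<omega>) \<le> c * psi_norm P \<psi> ?g"
      using c psi_norm_nonneg[OF \<psi> g] by (intro psi_norm_le(2)[OF \<psi>]) auto
    also have "\<dots> \<le> \<sigma>\<^sub>1 h"
      using inc[OF that] c by (simp add: \<sigma>\<^sub>1_def)
    finally show ?thesis .
  qed
  have Z_cont: "continuous_on T (Z_centered f I s n \<omega>)" if "\<omega> \<in> space M" for \<omega>
  proof -
    have "continuous_on T (\<lambda>t. \<integral>x. f x t \<partial>P)"
      by (rule continuous_on_mean[OF \<psi> f \<sigma>(1,3) inc])
    then have "continuous_on T I"
      by (simp add: I cong: continuous_on_cong_simp)
    then show ?thesis
      unfolding Z_centered_def[abs_def]
      using measurable_space[OF s that] cont by (intro continuous_intros) auto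
  qed
  then have X_cont: "continuous_on T (\<lambda>t. X t \<omega>)" if "\<omega> \<in> space M" for \<omega>
    using that unfolding X_def by (intro continuous_intros) auto
  have \<sigma>\<^sub>1: "continuous_on {0..} \<sigma>\<^sub>1" "strict_mono_on {0..} \<sigma>\<^sub>1" "\<sigma>\<^sub>1 0 = 0"
    using \<sigma> c by (auto simp: \<sigma>\<^sub>1_def strict_mono_on_def intro!: continuous_on_mult_left)
  have int\<^sub>1: "set_integrable lborel {0<..<\<sigma>\<^sub>1 (diameter T) * p} (\<lambda>u. \<kappa> (massiveness T (inverse_fun \<sigma>\<^sub>1 u)))"
    using set_integrable_scaled[OF c int] unfolding \<sigma>\<^sub>1_def inverse_fun_scaled[OF c]
    by (simp add: mult.assoc)
  have S: "?S \<in> psi_space M \<psi>" "psi_norm M \<psi> ?S \<le> psi_norm M \<psi> (X t) + J" if "t \<in> T" for t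
    unfolding J_def
    by (rule psi_norm_Sup_le_entropy_integral[OF M \<psi> \<kappa> T(1) that X_space X_cont \<sigma>\<^sub>1 X_inc p int\<^sub>1];
        assumption)+
  have S_space: "?S \<in> psi_space M \<psi>" using S(1) T(2) by blast
  have "(psi_norm M \<psi> ?S - J) / c \<le> (INF t\<in>T. psi_norm P \<psi> (\<lambda>x. f x t))"
  proof (rule cINF_greatest[OF T(2)])
    fix t assume "t \<in> T"
    then have "psi_norm M \<psi> ?S \<le> c * psi_norm P \<psi> (\<lambda>x. f x t) + J"
      using S(2) X_norm by fastforce
    then show "(psi_norm M \<psi> ?S - J) / c \<le> psi_norm P \<psi> (\<lambda>x. f x t)"
      using c by (simp add: pos_divide_le_eq mult.commute)
  qed
  then have "psi_norm M \<psi> ?S \<le> c * (INF t\<in>T. psi_norm P \<psi> (\<lambda>x. f x t)) + J"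
    using c by (simp add: pos_divide_le_eq mult.commute)
  also have "\<dots> = B_hat P \<psi> C \<kappa> \<sigma> T f p"
    by (simp add: B_hat_def Let_def J_def \<sigma>\<^sub>1_def c_def)
  finally have norm: "psi_norm M \<psi> ?S \<le> B_hat P \<psi> C \<kappa> \<sigma> T f p" .
  then show nonneg: "0 \<le> B_hat P \<psi> C \<kappa> \<sigma> T f p"
    using psi_norm_nonneg[OF \<psi> S_space] by simp
  have "moment_bound M \<psi> (B_hat P \<psi> C \<kappa> \<sigma> T f p) ?S"
    using moment_bound_iff[OF \<psi> nonneg] S_space norm by blast
  from moment_bound_cmult[OF \<psi> this nonneg, of "1 / sqrt (real n)"]
  have "moment_bound M \<psi> (B_hat P \<psi> C \<kappa> \<sigma> T f p / sqrt (real n)) (\<lambda>\<omega>. 1 / sqrt (real n) * ?S \<omega>)"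
    by simp
  then show "moment_bound M \<psi> (B_hat P \<psi> C \<kappa> \<sigma> T f p / sqrt (real n))
      (\<lambda>\<omega>. SUP t\<in>T. \<bar>Z_centered f I s n \<omega> t\<bar>)"
  proof (rule moment_bound_cong)
    show "1 / sqrt (real n) * ?S \<omega> = (SUP t\<in>T. \<bar>Z_centered f I s n \<omega> t\<bar>)" if "\<omega> \<in> space M" for \<omega>
      using Sup_abs_cmult[OF T Z_cont[OF that], of "sqrt (real n)"] n by (simp add: X_def)
  qed
qed

text \<open>
  The first claim drops the factor \<open>1 / sqrt n \<le> 1\<close> of the preceding lemma; the second one keeps it
  and applies Markov's inequality to every moment of order \<open>u \<ge> 1\<close>.
\<close>

theorem theorem9p7:
  fixes \<mu> P :: "'s measure" and dens :: "'s \<Rightarrow> real"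
    and T :: "'t::metric_space set" and f :: "'s \<Rightarrow> 't \<Rightarrow> real" and I :: "'t \<Rightarrow> real"
    and M :: "'w measure" and s :: "nat \<Rightarrow> 'w \<Rightarrow> 's" and n :: nat
    and \<psi> \<sigma> :: "real \<Rightarrow> real" and C :: real and \<kappa> :: "nat \<Rightarrow> real"
  assumes "sigma_finite_measure \<mu>"
    and "\<And>x. x \<in> space \<mu> \<Longrightarrow> 0 \<le> dens x"
    and "has_bochner_integral \<mu> dens 1"
    and "P = density \<mu> (\<lambda>x. ennreal (dens x))"
    and "compact T" and "T \<noteq> {}"
    and "\<And>t. t \<in> T \<Longrightarrow> (\<lambda>x. f x t) \<in> borel_measurable \<mu>"
    and "\<And>x. x \<in> space \<mu> \<Longrightarrow> continuous_on T (f x)"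
    and "\<And>t. t \<in> T \<Longrightarrow> has_bochner_integral \<mu> (\<lambda>x. f x t * dens x) (I t)"
    and "psi_function \<psi>"
    and "\<And>t. t \<in> T \<Longrightarrow> (\<lambda>x. f x t) \<in> psi_space P \<psi>"
    and "prob_space M"
    and "C > 0" and "condition_H M \<psi> C"
    and "majorizing_characteristic M \<psi> \<kappa>"
    and "n \<ge> 1"
    and "prob_space.indep_vars M (\<lambda>_. P) s {1..n}"
    and "\<And>i. i \<in> {1..n} \<Longrightarrow> distr M P (s i) = P"
    and "continuous_on {0..} \<sigma>" and "strict_mono_on {0..} \<sigma>" and "\<sigma> 0 = 0"
    and "\<And>h t t'. 0 \<le> h \<Longrightarrow> t \<in> T \<Longrightarrow> t' \<in> T \<Longrightarrow> dist t t' \<le> h \<Longrightarrow>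
           psi_norm P \<psi> (\<lambda>x. f x t - f x t') \<le> \<sigma> h"
    and "\<And>z. z > 0 \<Longrightarrow> set_integrable lborel ({0<..<z} \<inter> \<sigma> ` {0..})
           (\<lambda>u. \<kappa> (massiveness T (inverse_fun \<sigma> u)))"
  shows "\<forall>p. 0 < p \<and> p < 1 \<longrightarrow>
    ((\<lambda>\<omega>. SUP t\<in>T. \<bar>Z_centered f I s n \<omega> t\<bar>) \<in> psi_space M \<psi> \<and>
     psi_norm M \<psi> (\<lambda>\<omega>. SUP t\<in>T. \<bar>Z_centered f I s n \<omega> t\<bar>) \<le> B_hat P \<psi> C \<kappa> \<sigma> T f p) \<and>
    (\<forall>\<epsilon> \<delta>. \<epsilon> > 0 \<and>
       (INF u\<in>{1..}. (B_hat P \<psi> C \<kappa> \<sigma> T f p powr u * \<psi> u powr u) / (\<epsilon> * sqrt (real n)) powr u) \<le> \<delta>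
       \<longrightarrow> measure M {\<omega> \<in> space M. (SUP t\<in>T. \<bar>Z_mean f s n \<omega> t - I t\<bar>) > \<epsilon>} \<le> \<delta>)"
proof (intro allI impI)
  fix p :: real assume p: "0 < p \<and> p < 1"
  interpret prob_space M by fact
  let ?B = "B_hat P \<psi> C \<kappa> \<sigma> T f p"
  let ?S = "\<lambda>\<omega>. SUP t\<in>T. \<bar>Z_centered f I s n \<omega> t\<bar>"
  note \<psi> = \<open>psi_function \<psi>\<close>
  have n: "1 \<le> sqrt (real n)" using \<open>n \<ge> 1\<close> by simp
  have space_P: "space P = space \<mu>" using assms(4) by simp
  have mean: "(\<integral>x. f x t \<partial>P) = I t" if "t \<in> T" for t
  proof -
    have "(\<integral>x. f x t \<partial>P) = (\<integral>x. dens x *\<^sub>R f x t \<partial>\<mu>)"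
      unfolding assms(4)
      using assms(2,3) assms(7)[OF that] by (intro integral_density) (auto simp: has_bochner_integral_iff)
    then show ?thesis
      using has_bochner_integral_integral_eq[OF assms(9)[OF that]] by (simp add: mult.commute)
  qed
  have int: "set_integrable lborel {0<..<\<sigma> (diameter T) * p} (\<lambda>u. \<kappa> (massiveness T (inverse_fun \<sigma> u)))"
  proof (cases "0 < \<sigma> (diameter T) * p")
    case True
    \<comment> \<open>The intersection with the range of \<open>\<sigma>\<close> in the entropy condition leaves this interval unchanged.\<close>
    have "{0<..<\<sigma> (diameter T) * p} \<subseteq> \<sigma> ` {0..}"
    proof
      fix y assume y: "y \<in> {0<..<\<sigma> (diameter T) * p}"
      have d: "0 \<le> diameter T" by (rule diameter_ge_0[OF compact_imp_bounded[OF assms(5)]])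
      have "\<sigma> (diameter T) * p \<le> \<sigma> (diameter T)"
        using True p by (simp add: zero_less_mult_iff)
      then have "y \<le> \<sigma> (diameter T)" "0 \<le> y" using y by auto
      from inverse_fun_props[OF assms(19,20,21) d this(2,1)] show "y \<in> \<sigma> ` {0..}"
        by (metis atLeast_iff image_eqI)
    qed
    then show ?thesis
      using assms(23)[OF True] by (simp add: Int_absorb2)
  qed (simp add: set_integrable_def)
  have cont: "continuous_on T (f x)" if "x \<in> space P" for x
    using assms(8) that space_P by simp
  have B: "0 \<le> ?B" and S: "moment_bound M \<psi> (?B / sqrt (real n)) ?S"
    using moment_bound_Sup_Z_centered[OF assms(12) \<psi> assms(13,14,15,16,17,18,5,6,11) cont mean assms(19,20,21,22) _ _ int] p
    by blast+
  have "moment_bound M \<psi> ?B ?S"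
    by (rule moment_bound_mono[OF \<psi> S]) (use B n in \<open>auto simp: divide_le_eq mult_le_cancel_left1\<close>)
  then have part1: "?S \<in> psi_space M \<psi> \<and> psi_norm M \<psi> ?S \<le> ?B"
    using moment_bound_iff[OF \<psi> B] by blast
  have part2: "measure M {\<omega> \<in> space M. (SUP t\<in>T. \<bar>Z_mean f s n \<omega> t - I t\<bar>) > \<epsilon>} \<le> \<delta>"
    if \<epsilon>: "\<epsilon> > 0"
      and \<delta>: "(INF u\<in>{1..}. (?B powr u * \<psi> u powr u) / (\<epsilon> * sqrt (real n)) powr u) \<le> \<delta>" for \<epsilon> \<delta>
  proof -
    have "Z_mean f s n \<omega> t - I t = Z_centered f I s n \<omega> t" for \<omega> t
      using \<open>n \<ge> 1\<close> by (simp add: Z_mean_def Z_centered_def sum_subtractf field_simps)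
    then have "measure M {\<omega> \<in> space M. (SUP t\<in>T. \<bar>Z_mean f s n \<omega> t - I t\<bar>) > \<epsilon>}
        = measure M {\<omega> \<in> space M. ?S \<omega> > \<epsilon>}" by simp
    also have "\<dots> \<le> measure M {\<omega> \<in> space M. \<epsilon> \<le> ?S \<omega>}"
    proof (rule finite_measure_mono)
      have [measurable]: "?S \<in> borel_measurable M" using S by (simp add: moment_bound_def)
      show "{\<omega> \<in> space M. \<epsilon> \<le> ?S \<omega>} \<in> sets M" by measurable
    qed auto
    also have "\<dots> \<le> (INF u\<in>{1..}. (?B powr u * \<psi> u powr u) / (\<epsilon> * sqrt (real n)) powr u)"
    proof (rule cINF_greatest)
      fix u :: real assume "u \<in> {1..}"
      then have "measure M {\<omega> \<in> space M. \<epsilon> \<le> ?S \<omega>}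
          \<le> (?B / sqrt (real n) * \<psi> u) powr u / \<epsilon> powr u"
        using moment_bound_tail[OF assms(12) S] \<epsilon> by simp
      then show "measure M {\<omega> \<in> space M. \<epsilon> \<le> ?S \<omega>}
          \<le> (?B powr u * \<psi> u powr u) / (\<epsilon> * sqrt (real n)) powr u"
        by (simp add: powr_mult powr_divide mult.commute)
    qed simp
    also note \<delta>
    finally show ?thesis .
  qed
  show "(?S \<in> psi_space M \<psi> \<and> psi_norm M \<psi> ?S \<le> ?B) \<and>
    (\<forall>\<epsilon> \<delta>. \<epsilon> > 0 \<and>
       (INF u\<in>{1..}. (?B powr u * \<psi> u powr u) / (\<epsilon> * sqrt (real n)) powr u) \<le> \<delta>
       \<longrightarrow> measure M {\<omega> \<in> space M. (SUP t\<in>T. \<bar>Z_mean f s n \<omega> t - I t\<bar>) > \<epsilon>} \<le> \<delta>)"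
    using part1 part2 by blast
qed

end
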